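(* Let $f\colon[0,\infty)\times[0,\infty)\times\mathbb R^n\to\mathbb R^n$ satisfy: (a) for every $r>0$, $f$ is bounded and continuous when restricted to $[0,\infty)\times[0,\infty)\times\{x\in\mathbb R^n: |x|\le r\}$; (b) for every $r>0$ there exist a modulus of continuity $\theta_r$ and a constant $L_r>0$ such that $|f(\tau,t_1,x_1)-f(\tau,t_2,x_2)|\le\theta_r(|t_1-t_2|)+L_r|x_1-x_2|$ for all $\tau,t_1,t_2\ge 0$ and $|x_1|,|x_2|\le r$; (c) for every $(t,x)\in[0,\infty)\times\mathbb R^n$ the limit $\hat f(t,x):=\lim_{T\to\infty}\frac1T\int_0^T f(s,t,x)\,ds$ exists; (d) for every $r>0$, $\hat f(t,x)=\lim_{T\to\infty}\frac1T\int_\tau^{T+\tau} f(s,t,x)\,ds$ uniformly for $(\tau,t,x)\in[0,\infty)\times[0,\infty)\times\{|x|\le r\}$. Assume also the existence of a uniform local attractor $\{\mathcal K_t: t\ge0\}$ for $dz/dt=\hat f(t,z)$ such that there exists $k>0$ with $\bigcup_{t\ge0}\mathcal K_t\subset\{x\in\mathbb R^n:|x|<k\}$. Take $\hat x\in\mathbb R^n$ with $\operatorname{dist}_{\mathbb R^n}(\hat x,\mathcal K_0)\le\mu$, where $\mu$ is the constant in the definition of uniform local attractor. Then, for all $\sigma>0$, there exist $t_\sigma>0$ and $\varepsilon_\sigma>0$ such that, if $0<\varepsilon<\varepsilon_\sigma$, then $\tilde x_\varepsilon(t;0,\hat x)$ exists for all $t>0$ and satisfies $$\operatorname{dist}_{\mathbb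 R^n}\big(\tilde x_\varepsilon(t;0,\hat x),\mathcal K_t\big)\le\sigma\quad\text{for all } t\ge t_\sigma;$$ or, equivalently, $x_\varepsilon(\tau;0,\hat x)$ exists for all $\tau>0$ and satisfies $\operatorname{dist}_{\mathbb R^n}\big(x_\varepsilon(\tau;0,\hat x),\mathcal K_{\varepsilon\tau}\big)\le\sigma$ for all $\tau\ge t_\sigma/\varepsilon$.
   Context: A modulus of continuity is a nondecreasing map $\theta\colon[0,\infty)\to[0,\infty]$ with $\lim_{r\to0^+}\theta(r)=0$. $|\cdot|$ is the Euclidean norm; $\operatorname{dist}_{\mathbb R^n}(x,\mathcal C)=\inf_{c\in\mathcal C}|x-c|$ and $\operatorname{dist}_{\mathbb R^n}(\mathcal C_1,\mathcal C_2)=\sup_{x\in\mathcal C_1}\operatorname{dist}_{\mathbb R^n}(x,\mathcal C_2)$. $\bar{\mathcal B}_\mu(\mathcal C)$ is the closure of $\{x:\operatorname{dist}_{\mathbb R^n}(x,\mathcal C)<\mu\}$. For $\varepsilon>0$, $x_\varepsilon(\tau;\tau^*,x^* )$ is the maximal solution (for $\tau\ge\tau^*$) of $dx/d\tau=\varepsilon f(\tau,\varepsilon\tau,x)$ with value $x^*$ at $\tau=\tau^*\ge0$; $\tilde x_\varepsilon(t;t^*,x^* )$ is the maximal solution (for $t\ge t^*$) of $dx/dt=f(t/\varepsilon,t,x)$ with value $x^*$ at $t=t^*\ge0$; so $\tilde x_\varepsilon(\varepsilon\tau;\varepsilon\tau^*,x^* )=x_\varepsilon(\tau;\tau^*,x^*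 )$. $\tilde z(t;t^*,x^* )$ is the maximal solution (for $t\ge t^*$) of $dz/dt=\hat f(t,z)$ with value $x^*$ at $t=t^*\ge0$, and $\tilde z(t;t^*,\mathcal C):=\{\tilde z(t;t^*,x^* ):x^*\in\mathcal C\}$. A family $\{\mathcal K_t:t\ge0\}$ of nonempty compact subsets of $\mathbb R^n$ is a uniform local attractor for $dz/dt=\hat f(t,z)$ if: it is invariant, i.e. $\tilde z(t;t^*,\mathcal K_{t^*})=\mathcal K_t$ for all $t\ge t^*\ge0$; and there exists $\mu>0$ such that for all $t^*\ge0$ and $x^*\in\bar{\mathcal B}_\mu(\mathcal K_{t^*})$ the solution $\tilde z(t;t^*,x^* )$ exists for all $t\ge t^*$, and $\lim_{t\to\infty}\operatorname{dist}_{\mathbb R^n}\big(\tilde z(t+t^*;t^*,\bar{\mathcal B}_\mu(\mathcal K_{t^*})),\mathcal K_{t+t^*}\big)=0$ uniformly for $t^*\ge0$. *)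

theory Defs
  imports "HOL-Analysis.Analysis"
begin

definition modulus_of_continuity :: "(real \<Rightarrow> ennreal) \<Rightarrow> bool" where
  "modulus_of_continuity \<theta> \<longleftrightarrow> mono_on {0..} \<theta> \<and> (\<theta> \<longlongrightarrow> 0) (at_right 0)"

(* One-sided (non-symmetric); extended-valued, so that the supremum over an
   unbounded set C1 is infinite rather than unspecified. *)
definition semidist :: "'a::metric_space set \<Rightarrow> 'a set \<Rightarrow> ennreal" where
  "semidist C1 C2 = (SUP x\<in>C1. ennreal (infdist x C2))"

definition closed_nbhd :: "real \<Rightarrow> 'a::metric_space set \<Rightarrow> 'a set" where
  "closed_nbhd \<mu> C = closure {x. infdist x C < \<mu>}"

text \<open>A forward solution of \<open>dx/dt = g(t, x)\<close>, \<open>x(t0) = x0\<close> is a partial map of time whose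
  domain is an interval with least element \<open>t0\<close>; the derivative at \<open>t0\<close> is one-sided.\<close>

definition ivp_solution ::
  "(real \<Rightarrow> 'a \<Rightarrow> 'a) \<Rightarrow> real \<Rightarrow> 'a::real_normed_vector \<Rightarrow> (real \<rightharpoonup> 'a) \<Rightarrow> bool" where
  "ivp_solution g t0 x0 u \<longleftrightarrow>
     is_interval (dom u) \<and> dom u \<subseteq> {t0..} \<and> u t0 = Some x0 \<and>
     (\<forall>t\<in>dom u. ((\<lambda>s. the (u s)) has_vector_derivative g t (the (u t))) (at t within dom u))"

definition maximal_ivp_solution ::
  "(real \<Rightarrow> 'a \<Rightarrow> 'a) \<Rightarrow> real \<Rightarrow> 'a::real_normed_vector \<Rightarrow> (real \<rightharpoonup> 'a) \<Rightarrow> bool" where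
  "maximal_ivp_solution g t0 x0 u \<longleftrightarrow>
     ivp_solution g t0 x0 u \<and> (\<forall>v. ivp_solution g t0 x0 v \<and> u \<subseteq>\<^sub>m v \<longrightarrow> v = u)"

(* Meaningful when the maximal solution is unique, e.g. if g is continuous and locally
   Lipschitz in x. The solution exists at time t iff t lies in dom (max_sol g t0 x0). *)
definition max_sol ::
  "(real \<Rightarrow> 'a \<Rightarrow> 'a) \<Rightarrow> real \<Rightarrow> 'a::real_normed_vector \<Rightarrow> (real \<rightharpoonup> 'a)" where
  "max_sol g t0 x0 = (THE u. maximal_ivp_solution g t0 x0 u)"

definition max_sol_image ::
  "(real \<Rightarrow> 'a \<Rightarrow> 'a) \<Rightarrow> real \<Rightarrow> 'a::real_normed_vector set \<Rightarrow> real \<Rightarrow> 'a set" where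
  "max_sol_image g t0 C t = {z. \<exists>x\<in>C. max_sol g t0 x t = Some z}"

(* The radius mu of attraction is kept as a parameter, to be referred to elsewhere;
   only the sets K t with t >= 0 matter. *)
definition uniform_local_attractor ::
  "(real \<Rightarrow> 'a \<Rightarrow> 'a) \<Rightarrow> (real \<Rightarrow> 'a::real_normed_vector set) \<Rightarrow> real \<Rightarrow> bool" where
  "uniform_local_attractor g K \<mu> \<longleftrightarrow>
     (\<forall>t\<ge>0. compact (K t) \<and> K t \<noteq> {}) \<and>
     (\<forall>s\<ge>0. \<forall>t\<ge>s. max_sol_image g s (K s) t = K t) \<and>
     \<mu> > 0 \<and>
     (\<forall>s\<ge>0. \<forall>x\<in>closed_nbhd \<mu> (K s). \<forall>t\<ge>s. t \<in> dom (max_sol g s x)) \<and>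
     (\<forall>e::real. e > 0 \<longrightarrow>
        (\<forall>\<^sub>F t in at_top. \<forall>s\<ge>0.
           semidist (max_sol_image g s (closed_nbhd \<mu> (K s)) (t + s)) (K (t + s)) < ennreal e))"

definition time_mean ::
  "(real \<Rightarrow> real \<Rightarrow> 'a \<Rightarrow> 'a) \<Rightarrow> real \<Rightarrow> real \<Rightarrow> real \<Rightarrow> 'a::euclidean_space \<Rightarrow> 'a" where
  "time_mean f T \<tau> t x = (1 / T) *\<^sub>R integral {\<tau>..T + \<tau>} (\<lambda>s. f s t x)"

definition averaged ::
  "(real \<Rightarrow> real \<Rightarrow> 'a \<Rightarrow> 'a) \<Rightarrow> real \<Rightarrow> 'a::euclidean_space \<Rightarrow> 'a" where
  "averaged f t x = Lim at_top (\<lambda>T. time_mean f T 0 t x)"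

definition fast_time_sol ::
  "(real \<Rightarrow> real \<Rightarrow> 'a \<Rightarrow> 'a) \<Rightarrow> real \<Rightarrow> real \<Rightarrow> 'a::real_normed_vector \<Rightarrow> (real \<rightharpoonup> 'a)" where
  "fast_time_sol f \<epsilon> = max_sol (\<lambda>\<tau> x. \<epsilon> *\<^sub>R f \<tau> (\<epsilon> * \<tau>) x)"

definition slow_time_sol ::
  "(real \<Rightarrow> real \<Rightarrow> 'a \<Rightarrow> 'a) \<Rightarrow> real \<Rightarrow> real \<Rightarrow> 'a::real_normed_vector \<Rightarrow> (real \<rightharpoonup> 'a)" where
  "slow_time_sol f \<epsilon> = max_sol (\<lambda>t x. f (t / \<epsilon>) t x)"

end

(* On a time interval of fixed length T the solution of the fast system and the solution of the
   averaged system with the same initial value differ by at most delta, once epsilon is small,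
   uniformly in the starting time: cut the interval into short steps, on which the slow
   variables are frozen, and apply Gronwall's inequality.
   The attractor is uniformly stable: every solution of the averaged system starting eta-close
   to K_s stays close to K_t for t >= s, and is (eta/2)-close after a time T independent of s.
   The averaged solution of xhat is bounded and (eta/2)-close to the attractor at time T, so the
   fast solution is eta-close there; restarting the comparison at T, 2T, ... keeps it eta-close
   at all multiples of T and sigma-close in between. In particular it never leaves a fixed ball,
   so it is global. *)
theory Submission
  imports Defs
begin

section \<open>Gronwall's inequality and global solutions\<close>

text \<open>The estimates on \<open>f\<close> hold only on balls, and nothing guarantees in advance
  that fast solutions are global, so the comparison cannot start from the given equations. Both
  fields are therefore composed with the projection onto a large ball. The cut-off fields are
  bounded and Lipschitz in the state, so their solutions live on a whole half-line, and existence
  for the original equation becomes the question whether a cut-off solution stays in the ball.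
  Closeness to the attractor answers it. The radius has to be fixed before \<epsilon>, because the
  threshold for \<epsilon> depends on it. On the first time interval only compactness of the orbit
  bounds the averaged solution of \<open>xhat\<close>, so this bound enters the radius and the
  threshold depends on \<open>xhat\<close>. Errors do not accumulate: each comparison restarts the
  averaged solution at the current point of the fast one. Attraction leaves a distance of at most
  \<eta>/2 at the end of a block, and the comparison spends the other \<eta>/2.\<close>

lemma gronwall:
  fixes \<phi> :: "real \<Rightarrow> real"
  assumes cont: "continuous_on {a..b} \<phi>" and L: "L \<ge> 0"
    and le: "\<And>t. t \<in> {a..b} \<Longrightarrow> \<phi> t \<le> C + L * integral {a..t} \<phi>"
    and t: "t \<in> {a..b}"
  shows "\<phi> t \<le> C * exp (L * (t - a))"
proof -
  \<comment> \<open>The right-hand side of \<open>le\<close> times an integrating factor. By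
    \<open>le\<close> and \<open>L \<ge> 0\<close> its derivative is nonpositive, and its value at
    \<open>a\<close> is \<open>C\<close>.\<close>
  define \<Phi> where "\<Phi> = (\<lambda>t. exp (- L * (t - a)) * (C + L * integral {a..t} \<phi>))"
  have d: "(\<Phi> has_real_derivative exp (- L * (s - a)) * (L * (\<phi> s - (C + L * integral {a..s} \<phi>))))
      (at s within {a..b})" if "s \<in> {a..b}" for s
    unfolding \<Phi>_def using integral_has_real_derivative[OF cont that]
    by (auto intro!: derivative_eq_intros simp: algebra_simps)
  have "\<exists>s\<in>{a..t}. \<Phi> t - \<Phi> a = (t - a) * (exp (- L * (s - a)) * (L * (\<phi> s - (C + L * integral {a..s} \<phi>))))"
  proof (rule mvt_very_simple)
    show "a \<le> t" using t by simp
    show "(\<Phi> has_derivative (\<lambda>h. h * (exp (- L * (s - a)) * (L * (\<phi> s - (C + L * integral {a..s} \<phi>))))))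
        (at s within {a..t})" if "a \<le> s" "s \<le> t" for s
      using DERIV_subset[OF d[of s], of "{a..t}"] that t
      by (simp add: has_field_derivative_def mult_commute_abs)
  qed
  then obtain s where s: "s \<in> {a..t}"
    and "\<Phi> t - \<Phi> a = (t - a) * (exp (- L * (s - a)) * (L * (\<phi> s - (C + L * integral {a..s} \<phi>))))"
    by blast
  moreover have "(t - a) * (exp (- L * (s - a)) * (L * (\<phi> s - (C + L * integral {a..s} \<phi>)))) \<le> 0"
    using le[of s] s t L by (intro mult_nonneg_nonpos) auto
  ultimately have "\<Phi> t \<le> \<Phi> a" by linarith
  then have "\<Phi> t \<le> C" by (simp add: \<Phi>_def)
  then have "C + L * integral {a..t} \<phi> \<le> C * exp (L * (t - a))"
    by (simp add: \<Phi>_def exp_minus inverse_eq_divide pos_divide_le_eq)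
  with le[OF t] show ?thesis by simp
qed

lemma at_within_atLeast_eq_atLeastAtMost:
  fixes t :: real
  assumes "t < b"
  shows "at t within {a..} = at t within {a..b}"
  by (rule at_within_nhd[of _ "{..<b}"]) (use assms in auto)

lemma integral_has_vector_derivative_atLeast:
  fixes h :: "real \<Rightarrow> 'a::banach"
  assumes "continuous_on {s..} h" "s \<le> t"
  shows "((\<lambda>t. integral {s..t} h) has_vector_derivative h t) (at t within {s..})"
proof -
  have "continuous_on {s..t+1} h" using assms by (auto intro: continuous_on_subset)
  from integral_has_vector_derivative[OF this, of t] assms
  show ?thesis by (simp add: at_within_atLeast_eq_atLeastAtMost[of t "t+1"])
qed

text \<open>Meant for fields composed with \<open>cutoff r\<close>, which satisfy both global
  estimates. Solving on the half-line at once avoids continuing local solutions.\<close>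

lemma exists_global_solution:
  fixes g :: "real \<Rightarrow> 'a::banach \<Rightarrow> 'a"
  assumes cont: "continuous_on ({s..} \<times> UNIV) (\<lambda>(t, x). g t x)"
    and bnd: "\<And>t x. t \<ge> s \<Longrightarrow> norm (g t x) \<le> M"
    and lip: "\<And>t x y. t \<ge> s \<Longrightarrow> norm (g t x - g t y) \<le> L * norm (x - y)" and L: "L > 0"
  shows "\<exists>u. u s = x0 \<and> (\<forall>t\<ge>s. (u has_vector_derivative g t (u t)) (at t within {s..}))"
proof -
  \<comment> \<open>Writing \<open>u = E y\<close> turns the Picard operator into a contraction of the bounded
    continuous functions on the whole half-line; \<open>max s t\<close> extends them to the line.\<close>
  define E where "E = (\<lambda>t::real. exp (2 * L * (t - s)))"
  define h where "h = (\<lambda>(y::real \<Rightarrow>\<^sub>C 'a) t. g t (E t *\<^sub>R apply_bcontfun y t))"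
  define I where "I = (\<lambda>y t. integral {s..t} (h y))"
  define \<Psi> where "\<Psi> = (\<lambda>y t. inverse (E (max s t)) *\<^sub>R (x0 + I y (max s t)))"
  have Epos: "E t > 0" for t by (simp add: E_def)
  have M: "M \<ge> 0" using bnd[of s undefined] norm_ge_zero order_trans by blast
  have hcont: "continuous_on {s..} (h y)" for y
  proof -
    have "continuous_on {s..} ((\<lambda>(t, x). g t x) \<circ> (\<lambda>t. (t, E t *\<^sub>R apply_bcontfun y t)))"
      by (rule continuous_on_compose)
        (auto intro!: continuous_intros continuous_on_subset[OF cont] simp: E_def)
    then show ?thesis by (simp add: h_def o_def)
  qed
  have hint: "h y integrable_on {s..t}" for y t
    by (rule integrable_continuous_real) (auto intro: continuous_on_subset[OF hcont])
  have Ider: "(I y has_vector_derivative h y t) (at t within {s..})" if "t \<ge> s" for y t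
    unfolding I_def by (rule integral_has_vector_derivative_atLeast[OF hcont that])
  have Icont: "continuous_on {s..} (I y)" for y
    by (rule continuous_on_vector_derivative[OF Ider]) simp
  have Ibound: "norm (I y t) \<le> M * (t - s)" if "t \<ge> s" for y t
    unfolding I_def
  proof (rule integral_bound[OF that])
    show "continuous_on {s..t} (h y)" by (rule continuous_on_subset[OF hcont]) auto
  qed (simp add: h_def bnd)
  have \<Psi>cont: "continuous_on UNIV (\<Psi> y)" for y
  proof -
    have "continuous_on UNIV (\<lambda>t. I y (max s t))"
      by (rule continuous_on_compose2[OF Icont]) (auto intro!: continuous_intros)
    then show ?thesis unfolding \<Psi>_def using Epos
      by (auto intro!: continuous_intros simp: E_def)
  qed
  have \<Psi>bound: "norm (\<Psi> y t) \<le> norm x0 + M / (2 * L)" for y t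
  proof -
    define r where "r = max s t"
    have r: "r \<ge> s" by (simp add: r_def)
    have E1: "E r \<ge> 1" using r L by (simp add: E_def)
    \<comment> \<open>The integral grows at most linearly while the weight grows at least linearly,
      so their quotient stays bounded.\<close>
    have "1 + 2 * L * (r - s) \<le> E r" unfolding E_def by (rule exp_ge_add_one_self)
    then have "(r - s) / E r \<le> 1 / (2 * L)" using L Epos[of r] by (simp add: field_simps)
    then have "M * ((r - s) / E r) \<le> M * (1 / (2 * L))" using M by (rule mult_left_mono)
    moreover have "norm x0 / E r \<le> norm x0" using E1 Epos[of r]
      by (simp add: divide_le_eq mult_le_cancel_left1)
    moreover have "norm (\<Psi> y t) \<le> (norm x0 + M * (r - s)) / E r"
      unfolding \<Psi>_def r_def[symmetric] using Epos[of r] Ibound[OF r, of y] norm_triangle_ineq[of x0 "I y r"]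
      by (simp add: divide_inverse mult.commute)
    ultimately show ?thesis by (simp add: add_divide_distrib)
  qed
  have \<Psi>: "\<Psi> y \<in> bcontfun" for y
    unfolding bcontfun_def using \<Psi>cont \<Psi>bound
    by (auto simp: bounded_iff)
  define \<Gamma> where "\<Gamma> = (\<lambda>y. Bcontfun (\<Psi> y))"
  have \<Gamma>: "apply_bcontfun (\<Gamma> y) = \<Psi> y" for y
    unfolding \<Gamma>_def using \<Psi> by (rule Bcontfun_inverse)
  have "\<exists>!y. \<Gamma> y = y"
  proof (rule banach_fix_type[where c = "1/2"])
    show "\<forall>x y. dist (\<Gamma> x) (\<Gamma> y) \<le> 1 / 2 * dist x y"
    proof (intro allI dist_bound)
      fix x y :: "real \<Rightarrow>\<^sub>C 'a" and t :: real
      define r where "r = max s t"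
      have r: "r \<ge> s" by (simp add: r_def)
      \<comment> \<open>The factor 2 in the exponent of \<open>E\<close> is chosen for this:
        integrating \<open>L * E\<close> gives half of \<open>E\<close>, hence the contraction
        constant 1/2.\<close>
      have eint: "((\<lambda>v. L * E v * dist x y) has_integral E r / 2 * dist x y - E s / 2 * dist x y) {s..r}"
        using r L unfolding E_def
        by (intro fundamental_theorem_of_calculus)
          (auto intro!: derivative_eq_intros simp: has_real_derivative_iff_has_vector_derivative[symmetric])
      have "norm (I x r - I y r) = norm (integral {s..r} (\<lambda>v. h x v - h y v))"
        unfolding I_def using hint by (simp add: integral_diff)
      also have "\<dots> \<le> integral {s..r} (\<lambda>v. L * E v * dist x y)"
      proof (rule integral_norm_bound_integral)
        show "(\<lambda>v. h x v - h y v) integrable_on {s..r}" using hint by (auto intro: integrable_diff)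
        show "(\<lambda>v. L * E v * dist x y) integrable_on {s..r}" using eint by blast
        fix v assume v: "v \<in> {s..r}"
        have "norm (h x v - h y v) \<le> L * norm (E v *\<^sub>R apply_bcontfun x v - E v *\<^sub>R apply_bcontfun y v)"
          unfolding h_def using v by (intro lip) auto
        also have "\<dots> = L * E v * dist (apply_bcontfun x v) (apply_bcontfun y v)"
          using Epos[of v] by (simp add: dist_norm scaleR_diff_right[symmetric])
        also have "\<dots> \<le> L * E v * dist x y"
          using L Epos[of v] dist_bounded[of x v y] by (intro mult_left_mono) auto
        finally show "norm (h x v - h y v) \<le> L * E v * dist x y" .
      qed
      also have "\<dots> = E r / 2 * dist x y - E s / 2 * dist x y" using eint by (rule integral_unique)
      also have "\<dots> \<le> E r / 2 * dist x y" using Epos[of s] by simp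
      finally have "norm (I x r - I y r) \<le> E r / 2 * dist x y" .
      then have "inverse (E r) * norm (I x r - I y r) \<le> 1 / 2 * dist x y"
        using Epos[of r] by (simp add: field_simps)
      moreover have "\<Psi> x t - \<Psi> y t = inverse (E r) *\<^sub>R (I x r - I y r)"
        unfolding \<Psi>_def r_def[symmetric] by (simp add: scaleR_diff_right[symmetric])
      ultimately show "dist (apply_bcontfun (\<Gamma> x) t) (apply_bcontfun (\<Gamma> y) t) \<le> 1 / 2 * dist x y"
        unfolding \<Gamma> dist_norm using Epos[of r] by simp
    qed
  qed auto
  then obtain y where y: "\<Gamma> y = y" by blast
  define u where "u = (\<lambda>t. E t *\<^sub>R apply_bcontfun y t)"
  have u: "u t = x0 + I y t" if "t \<ge> s" for t
  proof -
    have "apply_bcontfun y t = \<Psi> y t" using \<Gamma>[of y] y by simp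
    then show ?thesis unfolding u_def \<Psi>_def using that Epos[of t] by (simp add: max_absorb2)
  qed
  have "(u has_vector_derivative g t (u t)) (at t within {s..})" if "t \<ge> s" for t
  proof (rule has_vector_derivative_transform[where f = "\<lambda>t. x0 + I y t"])
    show "((\<lambda>t. x0 + I y t) has_vector_derivative g t (u t)) (at t within {s..})"
      using Ider[OF that, of y] by (auto intro!: derivative_eq_intros simp: h_def u_def)
  qed (use that u in auto)
  moreover have "u s = x0" using u[of s] by (simp add: I_def)
  ultimately show ?thesis by blast
qed

text \<open>The Lipschitz estimate is asked only along the two solutions, so that a constant valid
  on a ball containing both will do.\<close>

lemma solution_dist_le:
  fixes x y :: "real \<Rightarrow> 'a::banach"
  assumes x: "\<And>t. t \<in> {a..b} \<Longrightarrow> (x has_vector_derivative g t (x t)) (at t within {a..b})"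
    and y: "\<And>t. t \<in> {a..b} \<Longrightarrow> (y has_vector_derivative g t (y t)) (at t within {a..b})"
    and lip: "\<And>t. t \<in> {a..b} \<Longrightarrow> norm (g t (x t) - g t (y t)) \<le> L * norm (x t - y t)"
    and L: "L \<ge> 0" and t: "t \<in> {a..b}"
  shows "norm (x t - y t) \<le> norm (x a - y a) * exp (L * (t - a))"
proof (rule gronwall[OF _ L _ t, of "\<lambda>t. norm (x t - y t)"])
  have cx: "continuous_on {a..b} x" by (rule continuous_on_vector_derivative[OF x])
  have cy: "continuous_on {a..b} y" by (rule continuous_on_vector_derivative[OF y])
  show c: "continuous_on {a..b} (\<lambda>t. norm (x t - y t))"
    using cx cy by (intro continuous_intros)
  fix t assume t: "t \<in> {a..b}"
  have sub: "{a..t} \<subseteq> {a..b}" using t by auto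
  have "((\<lambda>v. g v (x v) - g v (y v)) has_integral (x t - y t) - (x a - y a)) {a..t}"
    using t x y sub
    by (intro fundamental_theorem_of_calculus[of a t "\<lambda>v. x v - y v"])
      (auto intro!: derivative_eq_intros has_vector_derivative_within_subset[OF _ sub])
  then have i: "(\<lambda>v. g v (x v) - g v (y v)) integrable_on {a..t}"
    and e: "integral {a..t} (\<lambda>v. g v (x v) - g v (y v)) = (x t - y t) - (x a - y a)"
    by (auto simp: integral_unique)
  have "norm (integral {a..t} (\<lambda>v. g v (x v) - g v (y v))) \<le> integral {a..t} (\<lambda>v. L * norm (x v - y v))"
    using sub lip c
    by (intro integral_norm_bound_integral i integrable_continuous_real continuous_intros)
      (auto intro: continuous_on_subset[OF cx] continuous_on_subset[OF cy])
  then show "norm (x t - y t) \<le> norm (x a - y a) + L * integral {a..t} (\<lambda>t. norm (x t - y t))"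
    unfolding e using norm_triangle_ineq2[of "x t - y t" "x a - y a"] by simp
qed

section \<open>Uniqueness and maximal solutions\<close>

definition lipschitz_on_balls :: "(real \<Rightarrow> 'a::real_normed_vector \<Rightarrow> 'a) \<Rightarrow> bool" where
  "lipschitz_on_balls g \<longleftrightarrow>
    (\<forall>r>0. \<exists>L\<ge>0. \<forall>t\<ge>0. \<forall>x y. norm x \<le> r \<and> norm y \<le> r \<longrightarrow> norm (g t x - g t y) \<le> L * norm (x - y))"

lemma ivp_solution_vector_derivative:
  assumes "ivp_solution g t0 x0 u" "S \<subseteq> dom u" "t \<in> S"
  shows "((\<lambda>s. the (u s)) has_vector_derivative g t (the (u t))) (at t within S)"
  using assms by (auto simp: ivp_solution_def intro: has_vector_derivative_within_subset)

lemma ivp_solution_dom: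
  assumes "ivp_solution g t0 x0 u" "t \<in> dom u"
  shows "t0 \<le> t" "{t0..t} \<subseteq> dom u"
proof -
  show "t0 \<le> t" using assms by (auto simp: ivp_solution_def)
  have "t0 \<in> dom u" "is_interval (dom u)" using assms(1) by (auto simp: ivp_solution_def)
  then show "{t0..t} \<subseteq> dom u" using assms(2) unfolding is_interval_1 by (meson atLeastAtMost_iff subsetI)
qed

text \<open>Both solutions are continuous, so between \<open>t0\<close> and \<open>t\<close> they
  stay in a common ball. One Lipschitz constant applies there, and Gronwall's estimate starts from
  the difference 0.\<close>

lemma ivp_solution_unique:
  fixes g :: "real \<Rightarrow> 'a::banach \<Rightarrow> 'a"
  assumes g: "lipschitz_on_balls g" and t0: "t0 \<ge> 0"
    and u: "ivp_solution g t0 x0 u" and v: "ivp_solution g t0 x0 v"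
    and t: "t \<in> dom u" "t \<in> dom v"
  shows "u t = v t"
proof -
  define x where "x = (\<lambda>s. the (u s))"
  define y where "y = (\<lambda>s. the (v s))"
  have t0t: "t0 \<le> t" using ivp_solution_dom[OF u t(1)] by simp
  have dx: "(x has_vector_derivative g s (x s)) (at s within {t0..t})" if "s \<in> {t0..t}" for s
    unfolding x_def using ivp_solution_vector_derivative[OF u ivp_solution_dom(2)[OF u t(1)] that] .
  have dy: "(y has_vector_derivative g s (y s)) (at s within {t0..t})" if "s \<in> {t0..t}" for s
    unfolding y_def using ivp_solution_vector_derivative[OF v ivp_solution_dom(2)[OF v t(2)] that] .
  have "compact (x ` {t0..t} \<union> y ` {t0..t})"
    using continuous_on_vector_derivative[OF dx] continuous_on_vector_derivative[OF dy]
    by (intro compact_Un compact_continuous_image) auto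
  then obtain r where r: "r > 0" "\<And>z. z \<in> x ` {t0..t} \<union> y ` {t0..t} \<Longrightarrow> norm z \<le> r"
    using compact_imp_bounded bounded_pos by metis
  obtain L where L: "L \<ge> 0"
    "\<And>t x y. t \<ge> 0 \<Longrightarrow> norm x \<le> r \<Longrightarrow> norm y \<le> r \<Longrightarrow> norm (g t x - g t y) \<le> L * norm (x - y)"
    using g r(1) unfolding lipschitz_on_balls_def by metis
  have "norm (x t - y t) \<le> norm (x t0 - y t0) * exp (L * (t - t0))"
    by (rule solution_dist_le[OF dx dy]) (use r L t0 t0t in auto)
  moreover have "x t0 = y t0" using u v by (simp add: x_def y_def ivp_solution_def)
  ultimately have "x t = y t" by simp
  then show ?thesis using t by (auto simp: x_def y_def)
qed

lemma ivp_solution_of_function: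
  assumes "is_interval J" "J \<subseteq> {t0..}" "t0 \<in> J" "u t0 = x0"
    and "\<And>t. t \<in> J \<Longrightarrow> (u has_vector_derivative g t (u t)) (at t within J)"
  shows "ivp_solution g t0 x0 (\<lambda>t. if t \<in> J then Some (u t) else None)"
proof -
  have dom: "dom (\<lambda>t. if t \<in> J then Some (u t) else None) = J" by (auto split: if_splits)
  show ?thesis unfolding ivp_solution_def dom
    using assms by (auto intro: has_vector_derivative_transform)
qed

text \<open>Any two solutions agree where both are defined, so all of them can be glued; which one
  \<open>SOME\<close> picks at a given time does not matter.\<close>

lemma ivp_solution_union:
  fixes g :: "real \<Rightarrow> 'a::banach \<Rightarrow> 'a"
  assumes g: "lipschitz_on_balls g" and t0: "t0 \<ge> 0"
  shows "\<exists>U. ivp_solution g t0 x0 U \<and> (\<forall>v. ivp_solution g t0 x0 v \<longrightarrow> v \<subseteq>\<^sub>m U)"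
proof -
  define Q where "Q = (\<lambda>v t. ivp_solution g t0 x0 v \<and> t \<in> dom v)"
  define U where "U = (\<lambda>t. if \<exists>v. Q v t then (SOME v. Q v t) t else None)"
  have U: "U t = v t" if v: "ivp_solution g t0 x0 v" "t \<in> dom v" for v t
  proof -
    have Q: "Q v t" using v by (simp add: Q_def)
    then have "Q (SOME v. Q v t) t" by (rule someI[where P = "\<lambda>v. Q v t"])
    then have "(SOME v. Q v t) t = v t"
      using Q ivp_solution_unique[OF g t0] unfolding Q_def by blast
    then show ?thesis using Q unfolding U_def by auto
  qed
  have domU: "\<exists>v. Q v t" if "t \<in> dom U" for t
    using that by (auto simp: U_def split: if_splits)
  have sub: "dom v \<subseteq> dom U" if v: "ivp_solution g t0 x0 v" for v
  proof
    fix t assume "t \<in> dom v"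
    then show "t \<in> dom U" using U[OF v] by (metis domIff)
  qed
  \<comment> \<open>This solution puts \<open>t0\<close> into the domain of the union. At an
    isolated point the filter is \<open>bot\<close>, so the derivative condition is vacuous.\<close>
  have "ivp_solution g t0 x0 (\<lambda>t. if t \<in> {t0} then Some x0 else None)"
  proof (rule ivp_solution_of_function)
    have "at t0 within {t0} = bot" by (simp add: at_within_def)
    then show "((\<lambda>_. x0) has_vector_derivative g t x0) (at t within {t0})" if "t \<in> {t0}" for t
      using that by (simp add: has_vector_derivative_def has_derivative_def bounded_linear_scaleR_left)
  qed (auto simp: is_interval_1)
  from U[OF this, of t0] have Ut0: "U t0 = Some x0" by (simp add: dom_def)
  have below: "{t0..t} \<subseteq> dom U" if t: "t \<in> dom U" for t
  proof -
    obtain v where "Q v t" using domU[OF t] by blast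
    then show ?thesis using ivp_solution_dom(2)[of g t0 x0 v t] sub[of v] unfolding Q_def by blast
  qed
  have above: "dom U \<subseteq> {t0..}"
    using domU ivp_solution_dom(1) unfolding Q_def by fastforce
  have "is_interval (dom U)"
    unfolding is_interval_1
  proof (intro ballI allI impI)
    fix a b x assume "a \<in> dom U" "b \<in> dom U" "a \<le> x \<and> x \<le> b"
    then have "x \<in> {t0..b}" using above by auto
    then show "x \<in> dom U" using below[OF \<open>b \<in> dom U\<close>] by blast
  qed
  moreover have "((\<lambda>s. the (U s)) has_vector_derivative g t (the (U t))) (at t within dom U)"
    if t: "t \<in> dom U" for t
  proof -
    \<comment> \<open>The derivative depends only on the domain near \<open>t\<close>. If
      \<open>t\<close> is not the last point of \<open>dom U\<close>, a solution reaching a later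
      \<open>b\<close> has the same domain below \<open>b\<close>; if it is, a solution reaching
      \<open>t\<close> already has all of \<open>dom U\<close>.\<close>
    have "\<exists>v. Q v t \<and> at t within dom U = at t within dom v"
    proof (cases "\<exists>b\<in>dom U. t < b")
      case True
      then obtain b v where b: "t < b" "Q v b" using domU by blast
      have s: "{t0..b} \<subseteq> dom v" using b ivp_solution_dom(2) unfolding Q_def by blast
      have "dom U \<inter> {..<b} - {t} = dom v \<inter> {..<b} - {t}"
      proof -
        have "dom U \<inter> {..<b} \<subseteq> {t0..b}" using above by auto
        moreover have "dom v \<subseteq> dom U" using sub b unfolding Q_def by blast
        ultimately show ?thesis using s by blast
      qed
      then have "at t within dom U = at t within dom v"
        using b by (intro at_within_nhd[of _ "{..<b}"]) auto
      moreover have "t \<in> {t0..b}" using t above b by auto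
      ultimately show ?thesis using b s unfolding Q_def by blast
    next
      case False
      obtain v where v: "Q v t" using domU[OF t] by blast
      have "dom U \<subseteq> {t0..t}" using False above by (meson atLeastAtMost_iff atLeast_iff not_less subset_iff)
      moreover have "{t0..t} \<subseteq> dom v" using v ivp_solution_dom(2) unfolding Q_def by blast
      ultimately have "dom U = dom v" using v sub unfolding Q_def by blast
      then show ?thesis using v by auto
    qed
    then obtain v where v: "ivp_solution g t0 x0 v" "t \<in> dom v" and e: "at t within dom U = at t within dom v"
      unfolding Q_def by blast
    show ?thesis unfolding e
      by (rule has_vector_derivative_transform[where f = "\<lambda>s. the (v s)"])
        (use U v in \<open>auto simp: ivp_solution_def\<close>)
  qed
  ultimately have "ivp_solution g t0 x0 U"
    using Ut0 above by (simp add: ivp_solution_def)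
  moreover have "v \<subseteq>\<^sub>m U" if "ivp_solution g t0 x0 v" for v
    using U[OF that] by (simp add: map_le_def)
  ultimately show ?thesis by blast
qed

text \<open>A solution that extends all others is the only maximal one, so the \<open>THE\<close> in
  \<open>max_sol\<close> denotes it.\<close>

lemma max_sol_greatest:
  fixes g :: "real \<Rightarrow> 'a::banach \<Rightarrow> 'a"
  assumes g: "lipschitz_on_balls g" and t0: "t0 \<ge> 0"
  shows "ivp_solution g t0 x0 (max_sol g t0 x0)"
    and "ivp_solution g t0 x0 v \<Longrightarrow> v \<subseteq>\<^sub>m max_sol g t0 x0"
proof -
  obtain U where U: "ivp_solution g t0 x0 U" "\<And>v. ivp_solution g t0 x0 v \<Longrightarrow> v \<subseteq>\<^sub>m U"
    using ivp_solution_union[OF g t0] by blast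
  have "max_sol g t0 x0 = U"
    unfolding max_sol_def
  proof (rule the_equality)
    show "maximal_ivp_solution g t0 x0 U"
      unfolding maximal_ivp_solution_def using U map_le_antisym by blast
    show "w = U" if "maximal_ivp_solution g t0 x0 w" for w
      using that U unfolding maximal_ivp_solution_def by blast
  qed
  with U show "ivp_solution g t0 x0 (max_sol g t0 x0)"
    "ivp_solution g t0 x0 v \<Longrightarrow> v \<subseteq>\<^sub>m max_sol g t0 x0" by auto
qed

text \<open>The way to evaluate \<open>max_sol\<close>: exhibiting a solution on some interval
  \<open>J\<close> yields existence of the maximal solution at the times in \<open>J\<close>
  together with its values there.\<close>

lemma max_sol_eqI:
  fixes g :: "real \<Rightarrow> 'a::banach \<Rightarrow> 'a"
  assumes g: "lipschitz_on_balls g" and t0: "t0 \<ge> 0"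
    and J: "is_interval J" "J \<subseteq> {t0..}" "t0 \<in> J" "u t0 = x0"
    and u: "\<And>t. t \<in> J \<Longrightarrow> (u has_vector_derivative g t (u t)) (at t within J)"
    and t: "t \<in> J"
  shows "max_sol g t0 x0 t = Some (u t)"
proof -
  have "ivp_solution g t0 x0 (\<lambda>t. if t \<in> J then Some (u t) else None)"
    using J u by (rule ivp_solution_of_function)
  from max_sol_greatest(2)[OF g t0 this] t show ?thesis by (force simp: map_le_def dom_def)
qed

lemma max_sol_initial:
  fixes g :: "real \<Rightarrow> 'a::banach \<Rightarrow> 'a"
  assumes "lipschitz_on_balls g" "t0 \<ge> 0"
  shows "max_sol g t0 x0 t0 = Some x0"
  using max_sol_greatest(1)[OF assms] by (simp add: ivp_solution_def)

section \<open>Averaging on bounded time intervals\<close>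

text \<open>The interval from \<open>s\<close> to \<open>t\<close> consists of complete steps of
  length \<open>h\<close>, each contributing at most \<open>\<gamma> * h\<close>, and an incomplete
  one, where only the pointwise bound \<open>B\<close> is available.\<close>

lemma norm_integral_le_by_steps:
  fixes \<phi> :: "real \<Rightarrow> 'a::banach"
  assumes cont: "continuous_on {s..s + T} \<phi>"
    and B: "\<And>u. u \<in> {s..s + T} \<Longrightarrow> norm (\<phi> u) \<le> B"
    and h: "h > 0" and \<gamma>: "\<gamma> \<ge> 0"
    and step: "\<And>a. s \<le> a \<Longrightarrow> a + h \<le> s + T \<Longrightarrow> norm (integral {a..a + h} \<phi>) \<le> \<gamma> * h"
    and t: "t \<in> {s..s + T}"
  shows "norm (integral {s..t} \<phi>) \<le> \<gamma> * (t - s) + B * h"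
proof -
  have int: "\<phi> integrable_on {a..b}" if "s \<le> a" "b \<le> s + T" for a b
    using that by (intro integrable_continuous_real continuous_on_subset[OF cont]) auto
  have B0: "B \<ge> 0" using B[OF t] norm_ge_zero order_trans by blast
  have steps: "s + real n * h \<le> s + T \<Longrightarrow> norm (integral {s..s + real n * h} \<phi>) \<le> \<gamma> * (real n * h)" for n
  proof (induction n)
    case (Suc n)
    define a where "a = s + real n * h"
    have a: "s \<le> a" "a + h = s + real (Suc n) * h" "a + h \<le> s + T"
      using h Suc.prems by (auto simp: a_def algebra_simps)
    have "integral {s..a + h} \<phi> = integral {s..a} \<phi> + integral {a..a + h} \<phi>"
      using a h int by (intro Henstock_Kurzweil_Integration.integral_combine[symmetric]) auto
    moreover have "norm (integral {s..a} \<phi>) \<le> \<gamma> * (real n * h)"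
      unfolding a_def using a h by (intro Suc.IH) (simp add: a_def)
    ultimately have "norm (integral {s..a + h} \<phi>) \<le> \<gamma> * (real n * h) + \<gamma> * h"
      using step[OF a(1,3)] by (metis add_mono norm_triangle_le)
    then show ?case unfolding a(2) by (simp add: algebra_simps)
  qed simp
  define n where "n = nat \<lfloor>(t - s) / h\<rfloor>"
  define a where "a = s + real n * h"
  have n: "real n \<le> (t - s) / h" "(t - s) / h < real n + 1"
    using t h by (auto simp: n_def)
  have a: "s \<le> a" "a \<le> t" "t - a \<le> h" using n h by (auto simp: a_def field_simps)
  have eq: "integral {s..t} \<phi> = integral {s..a} \<phi> + integral {a..t} \<phi>"
    using a t int by (intro Henstock_Kurzweil_Integration.integral_combine[symmetric]) auto
  have "norm (integral {s..a} \<phi>) \<le> \<gamma> * (a - s)"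
    using steps[of n] a t by (simp add: a_def)
  moreover have "\<gamma> * (a - s) \<le> \<gamma> * (t - s)" using a \<gamma> by (intro mult_left_mono) auto
  moreover have "norm (integral {a..t} \<phi>) \<le> B * (t - a)"
    using a t by (intro integral_bound continuous_on_subset[OF cont] B) auto
  moreover have "B * (t - a) \<le> B * h" using a B0 by (intro mult_left_mono) auto
  ultimately show ?thesis
    unfolding eq using norm_triangle_ineq[of "integral {s..a} \<phi>" "integral {a..t} \<phi>"] by linarith
qed

text \<open>Substitution v = u/\<epsilon>. A slow step of fixed length \<open>h\<close> becomes an
  averaging window of length \<open>h / \<epsilon>\<close>, which is long when \<epsilon> is
  small.\<close>

lemma integral_fast_time:
  fixes f :: "real \<Rightarrow> real \<Rightarrow> 'a::euclidean_space \<Rightarrow> 'a"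
  assumes "\<epsilon> > 0" "h > 0" and int: "(\<lambda>v. f v t x) integrable_on {a / \<epsilon>..(a + h) / \<epsilon>}"
  shows "((\<lambda>u. f (u / \<epsilon>) t x) has_integral h *\<^sub>R time_mean f (h / \<epsilon>) (a / \<epsilon>) t x) {a..a + h}"
proof -
  have im: "(\<lambda>x. x / (1 / \<epsilon>)) ` {a / \<epsilon>..(a + h) / \<epsilon>} = {a..a + h}"
  proof -
    have "(\<lambda>x. x / (1 / \<epsilon>)) ` {a / \<epsilon>..(a + h) / \<epsilon>} = (*) \<epsilon> ` {a / \<epsilon>..(a + h) / \<epsilon>}"
      by (simp add: mult.commute)
    then show ?thesis using assms by (simp add: image_mult_atLeastAtMost)
  qed
  have "((\<lambda>u. f (1 / \<epsilon> * u) t x) has_integral (1 / \<bar>1 / \<epsilon>\<bar>) *\<^sub>R integral {a / \<epsilon>..(a + h) / \<epsilon>} (\<lambda>v. f v t x)) {a..a + h}"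
    using has_integral_stretch_real[OF integrable_integral[OF int], of "1 / \<epsilon>"] assms unfolding im by simp
  moreover have "(1 / \<bar>1 / \<epsilon>\<bar>) *\<^sub>R integral {a / \<epsilon>..(a + h) / \<epsilon>} (\<lambda>v. f v t x) = h *\<^sub>R time_mean f (h / \<epsilon>) (a / \<epsilon>) t x"
    using assms by (simp add: time_mean_def add_divide_distrib add.commute)
  ultimately show ?thesis by simp
qed

text \<open>All estimates are global in the state because the lemma is applied to cut-off fields.
  The threshold can be independent of the starting time because \<open>mean\<close> is uniform in
  the window's position \<tau> and in the slow time t.\<close>

lemma averaging_finite_time:
  fixes F :: "real \<Rightarrow> real \<Rightarrow> 'a::euclidean_space \<Rightarrow> 'a"
  assumes Fcont: "continuous_on ({0..} \<times> {0..} \<times> UNIV) (\<lambda>(\<tau>, t, x). F \<tau> t x)"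
    and Gcont: "continuous_on ({0..} \<times> UNIV) (\<lambda>(t, x). G t x)"
    and Fbound: "\<And>\<tau> t x. \<tau> \<ge> 0 \<Longrightarrow> t \<ge> 0 \<Longrightarrow> norm (F \<tau> t x) \<le> M"
    and Gbound: "\<And>t x. t \<ge> 0 \<Longrightarrow> norm (G t x) \<le> M"
    and Flip: "\<And>e::real. e > 0 \<Longrightarrow> \<exists>\<delta>>0. \<forall>\<tau>\<ge>0. \<forall>t1\<ge>0. \<forall>t2\<ge>0. \<forall>x1 x2. \<bar>t1 - t2\<bar> < \<delta> \<longrightarrow>
      norm (F \<tau> t1 x1 - F \<tau> t2 x2) \<le> e + L * norm (x1 - x2)"
    and Glip: "\<And>e::real. e > 0 \<Longrightarrow> \<exists>\<delta>>0. \<forall>t1\<ge>0. \<forall>t2\<ge>0. \<forall>x1 x2. \<bar>t1 - t2\<bar> < \<delta> \<longrightarrow>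
      norm (G t1 x1 - G t2 x2) \<le> e + L * norm (x1 - x2)"
    and mean: "\<And>e::real. e > 0 \<Longrightarrow> \<exists>T0. \<forall>T\<ge>T0. \<forall>\<tau>\<ge>0. \<forall>t\<ge>0. \<forall>x. norm (time_mean F T \<tau> t x - G t x) \<le> e"
    and L: "L > 0" and M: "M > 0" and \<delta>: "\<delta> > 0" and T: "T > 0"
  obtains \<epsilon>0 where "\<epsilon>0 > 0"
    and "\<And>\<epsilon> s x w t. 0 < \<epsilon> \<Longrightarrow> \<epsilon> < \<epsilon>0 \<Longrightarrow> 0 \<le> s \<Longrightarrow> x s = w s \<Longrightarrow>
      (\<And>t. t \<in> {s..s + T} \<Longrightarrow> (x has_vector_derivative F (t / \<epsilon>) t (x t)) (at t within {s..s + T})) \<Longrightarrow>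
      (\<And>t. t \<in> {s..s + T} \<Longrightarrow> (w has_vector_derivative G t (w t)) (at t within {s..s + T})) \<Longrightarrow>
      t \<in> {s..s + T} \<Longrightarrow> norm (x t - w t) \<le> \<delta>"
proof -
  \<comment> \<open>\<open>\<kappa>\<close> is the admissible size of the integrated perturbation,
    which Gronwall's inequality magnifies by at most \<open>exp (L * T)\<close>. Half of it,
    \<open>\<gamma> * T\<close>, goes to the complete steps; the other half pays for the incomplete
    last one.\<close>
  define \<kappa> where "\<kappa> = \<delta> / exp (L * T)"
  define \<gamma> where "\<gamma> = \<kappa> / (2 * T)"
  have pos: "\<kappa> > 0" "\<gamma> > 0" using \<delta> T by (auto simp: \<kappa>_def \<gamma>_def)
  \<comment> \<open>On each step an error \<open>e\<close> arises three times: from the mean and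
    from freezing the slow time in \<open>F\<close> and in \<open>G\<close>. Together they use half
    of the rate \<open>\<gamma>\<close>; the drift of the state uses the other half.\<close>
  define e where "e = \<gamma> / 6"
  have e: "e > 0" using pos by (simp add: e_def)
  obtain \<delta>1 where \<delta>1: "\<delta>1 > 0" "\<And>\<tau> t1 t2 x1 x2. \<tau> \<ge> 0 \<Longrightarrow> t1 \<ge> 0 \<Longrightarrow> t2 \<ge> 0 \<Longrightarrow> \<bar>t1 - t2\<bar> < \<delta>1 \<Longrightarrow>
      norm (F \<tau> t1 x1 - F \<tau> t2 x2) \<le> e + L * norm (x1 - x2)"
    using Flip[OF e] by metis
  obtain \<delta>2 where \<delta>2: "\<delta>2 > 0" "\<And>t1 t2 x1 x2. t1 \<ge> 0 \<Longrightarrow> t2 \<ge> 0 \<Longrightarrow> \<bar>t1 - t2\<bar> < \<delta>2 \<Longrightarrow>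
      norm (G t1 x1 - G t2 x2) \<le> e + L * norm (x1 - x2)"
    using Glip[OF e] by metis
  obtain T0 where T0: "\<And>T \<tau> t x. T \<ge> T0 \<Longrightarrow> \<tau> \<ge> 0 \<Longrightarrow> t \<ge> 0 \<Longrightarrow> norm (time_mean F T \<tau> t x - G t x) \<le> e"
    using mean[OF e] by metis
  \<comment> \<open>The first two entries keep the change of slow time within a step below
    \<open>\<delta>1\<close> and \<open>\<delta>2\<close>. The third controls the drift of the
    state, whose speed is at most \<open>M\<close>, and the fourth the incomplete last step.\<close>
  define h where "h = Min {\<delta>1 / 2, \<delta>2 / 2, \<gamma> / (4 * L * M), \<kappa> / (4 * M)}"
  have h: "h > 0" "h < \<delta>1" "h < \<delta>2" "h \<le> \<gamma> / (4 * L * M)" "h \<le> \<kappa> / (4 * M)"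
    using \<delta>1(1) \<delta>2(1) pos L M by (auto simp: h_def min_def)
  have hM: "4 * (L * (M * h)) \<le> \<gamma>" "4 * (M * h) \<le> \<kappa>"
    using h L M by (simp_all add: field_simps)
  obtain m where m: "m \<ge> T0" "m > 0" by (meson gt_ex linorder_le_cases order_less_le_trans order_refl)
  \<comment> \<open>For smaller \<epsilon> the window \<open>h / \<epsilon>\<close> is at least
    \<open>m\<close>, hence long enough for the mean to be \<open>e\<close>-close to its
    limit.\<close>
  define \<epsilon>0 where "\<epsilon>0 = h / m"
  have \<epsilon>0: "\<epsilon>0 > 0" using h m by (simp add: \<epsilon>0_def)
  show ?thesis
  proof (rule that[OF \<epsilon>0])
    fix \<epsilon> s t :: real and x w :: "real \<Rightarrow> 'a"
    assume \<epsilon>: "0 < \<epsilon>" "\<epsilon> < \<epsilon>0" and s: "0 \<le> s" and xw: "x s = w s"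
      and x: "\<And>t. t \<in> {s..s + T} \<Longrightarrow> (x has_vector_derivative F (t / \<epsilon>) t (x t)) (at t within {s..s + T})"
      and w: "\<And>t. t \<in> {s..s + T} \<Longrightarrow> (w has_vector_derivative G t (w t)) (at t within {s..s + T})"
      and t: "t \<in> {s..s + T}"
    have "h / \<epsilon> \<ge> m"
      using \<epsilon> h(1) m unfolding \<epsilon>0_def by (simp add: field_simps)
    then have h\<epsilon>: "h / \<epsilon> \<ge> T0" using m by simp
    have cx: "continuous_on {s..s + T} x" by (rule continuous_on_vector_derivative[OF x])
    have cw: "continuous_on {s..s + T} w" by (rule continuous_on_vector_derivative[OF w])
    have Fc: "continuous_on J (\<lambda>u. F (u / \<epsilon>) (p u) (q u))"
      if "continuous_on J p" "continuous_on J q" "J \<subseteq> {0..}" "p ` J \<subseteq> {0..}" for J p q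
    proof -
      have "continuous_on J ((\<lambda>(\<tau>, t, x). F \<tau> t x) \<circ> (\<lambda>u. (u / \<epsilon>, p u, q u)))"
        using that \<epsilon> by (intro continuous_on_compose continuous_intros continuous_on_subset[OF Fcont]) auto
      then show ?thesis by (simp add: o_def)
    qed
    have Gc: "continuous_on {s..s + T} (\<lambda>u. G u (w u))"
    proof -
      have "continuous_on {s..s + T} ((\<lambda>(t, x). G t x) \<circ> (\<lambda>u. (u, w u)))"
        using s by (intro continuous_on_compose continuous_intros cw continuous_on_subset[OF Gcont]) auto
      then show ?thesis by (simp add: o_def)
    qed
    \<comment> \<open>The difference of the fields is taken along \<open>w\<close>. Then x' - w' is
      \<open>\<phi>\<close> plus a difference of values of \<open>F\<close> at the two states, which
      the Lipschitz estimate makes fit for Gronwall's inequality.\<close>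
    define \<phi> where "\<phi> = (\<lambda>u. F (u / \<epsilon>) u (w u) - G u (w u))"
    have \<phi>c: "continuous_on {s..s + T} \<phi>" unfolding \<phi>_def
      using s by (intro continuous_intros Fc Gc cw) auto
    have wdiff: "norm (w u - w a) \<le> M * (u - a)" if "s \<le> a" "a \<le> u" "u \<le> s + T" for a u
    proof -
      have sub: "{a..u} \<subseteq> {s..s + T}" using that by auto
      have "((\<lambda>v. G v (w v)) has_integral w u - w a) {a..u}"
        using that sub by (intro fundamental_theorem_of_calculus has_vector_derivative_within_subset[OF w sub]) auto
      then have "w u - w a = integral {a..u} (\<lambda>v. G v (w v))" by (simp add: integral_unique)
      also have "norm \<dots> \<le> M * (u - a)"
        using that s sub by (intro integral_bound Gbound continuous_on_subset[OF Gc]) auto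
      finally show ?thesis .
    qed
    have step: "norm (integral {a..a + h} \<phi>) \<le> \<gamma> * h" if a: "s \<le> a" "a + h \<le> s + T" for a
    proof -
      \<comment> \<open>freeze slow time and state at the left end of the step, keeping only the fast time\<close>
      define c where "c = (\<lambda>u. F (u / \<epsilon>) a (w a) - G a (w a))"
      have sub: "{a..a + h} \<subseteq> {s..s + T}" using a by auto
      have "continuous_on {a / \<epsilon>..(a + h) / \<epsilon>} ((\<lambda>(\<tau>, t, x). F \<tau> t x) \<circ> (\<lambda>v. (v, a, w a)))"
        using a s \<epsilon> by (intro continuous_on_compose continuous_intros continuous_on_subset[OF Fcont])
          (auto intro: order_trans[rotated])
      then have "(\<lambda>v. F v a (w a)) integrable_on {a / \<epsilon>..(a + h) / \<epsilon>}"
        by (intro integrable_continuous_real) (simp add: o_def)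
      then have "((\<lambda>u. F (u / \<epsilon>) a (w a)) has_integral h *\<^sub>R time_mean F (h / \<epsilon>) (a / \<epsilon>) a (w a)) {a..a + h}"
        by (rule integral_fast_time[OF \<epsilon>(1) h(1)])
      from has_integral_diff[OF this has_integral_const_real[of "G a (w a)" a "a + h"]]
      have c_int: "(c has_integral h *\<^sub>R (time_mean F (h / \<epsilon>) (a / \<epsilon>) a (w a) - G a (w a))) {a..a + h}"
        using h(1) by (simp add: c_def scaleR_diff_right)
      have "norm (time_mean F (h / \<epsilon>) (a / \<epsilon>) a (w a) - G a (w a)) \<le> e"
        using a s \<epsilon> h\<epsilon> by (intro T0) auto
      then have "norm (integral {a..a + h} c) \<le> h * e"
        using c_int h(1) by (simp add: integral_unique)
      moreover have "norm (integral {a..a + h} (\<lambda>u. \<phi> u - c u)) \<le> (2 * e + 2 * (L * (M * h))) * (a + h - a)"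
      proof (rule integral_bound)
        show "continuous_on {a..a + h} (\<lambda>u. \<phi> u - c u)" unfolding c_def
          using a s by (intro continuous_intros continuous_on_subset[OF \<phi>c] Fc) auto
        fix u assume u: "u \<in> {a..a + h}"
        have "norm (w u - w a) \<le> M * (u - a)" using u a by (intro wdiff) auto
        also have "\<dots> \<le> M * h" using u M by (intro mult_left_mono) auto
        finally have wh: "L * norm (w u - w a) \<le> L * (M * h)" using L by simp
        have "norm (F (u / \<epsilon>) u (w u) - F (u / \<epsilon>) a (w a)) \<le> e + L * norm (w u - w a)"
          using u a s \<epsilon> h by (intro \<delta>1(2)) auto
        moreover have "norm (G u (w u) - G a (w a)) \<le> e + L * norm (w u - w a)"
          using u a s h by (intro \<delta>2(2)) auto
        moreover have "\<phi> u - c u = (F (u / \<epsilon>) u (w u) - F (u / \<epsilon>) a (w a)) - (G u (w u) - G a (w a))"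
          by (simp add: \<phi>_def c_def)
        ultimately show "norm (\<phi> u - c u) \<le> 2 * e + 2 * (L * (M * h))"
          using wh norm_triangle_ineq4[of "F (u / \<epsilon>) u (w u) - F (u / \<epsilon>) a (w a)" "G u (w u) - G a (w a)"]
          by simp
      qed (use h in auto)
      moreover have "integral {a..a + h} \<phi> = integral {a..a + h} c + integral {a..a + h} (\<lambda>u. \<phi> u - c u)"
      proof -
        have "\<phi> integrable_on {a..a + h}" by (intro integrable_continuous_real continuous_on_subset[OF \<phi>c] sub)
        then show ?thesis using c_int by (subst integral_diff) auto
      qed
      ultimately have "norm (integral {a..a + h} \<phi>) \<le> h * e + (2 * e + 2 * (L * (M * h))) * h"
        using norm_triangle_ineq[of "integral {a..a + h} c" "integral {a..a + h} (\<lambda>u. \<phi> u - c u)"] by simp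
      also have "\<dots> = (3 * e + 2 * (L * (M * h))) * h" by (simp add: algebra_simps)
      also have "\<dots> \<le> \<gamma> * h" using h hM by (intro mult_right_mono) (auto simp: e_def)
      finally show ?thesis .
    qed
    have perturb: "norm (integral {s..t} \<phi>) \<le> \<kappa>" if t: "t \<in> {s..s + T}" for t
    proof -
      have "norm (\<phi> u) \<le> 2 * M" if "u \<in> {s..s + T}" for u
        using Fbound[of "u / \<epsilon>" u "w u"] Gbound[of u "w u"] that s \<epsilon>
          norm_triangle_ineq4[of "F (u / \<epsilon>) u (w u)" "G u (w u)"] by (simp add: \<phi>_def)
      from norm_integral_le_by_steps[OF \<phi>c this h(1) _ step t] pos
      have "norm (integral {s..t} \<phi>) \<le> \<gamma> * (t - s) + 2 * M * h" by simp
      also have "\<gamma> * (t - s) \<le> \<gamma> * T" using t pos by (intro mult_left_mono) auto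
      also have "\<gamma> * T = \<kappa> / 2" using T by (simp add: \<gamma>_def)
      finally show ?thesis using hM by simp
    qed
    have "norm (x t - w t) \<le> \<kappa> * exp (L * (t - s))"
    proof (rule gronwall[OF _ _ _ t, of "\<lambda>t. norm (x t - w t)"])
      show c: "continuous_on {s..s + T} (\<lambda>t. norm (x t - w t))" by (intro continuous_intros cx cw)
      fix t assume t: "t \<in> {s..s + T}"
      have sub: "{s..t} \<subseteq> {s..s + T}" using t by auto
      define \<eta> where "\<eta> = (\<lambda>v. F (v / \<epsilon>) v (x v) - F (v / \<epsilon>) v (w v))"
      have "\<eta> integrable_on {s..t}" unfolding \<eta>_def
        using sub s by (intro integrable_continuous_real continuous_intros Fc
            continuous_on_subset[OF cx] continuous_on_subset[OF cw]) auto
      moreover have "\<phi> integrable_on {s..t}"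
        by (intro integrable_continuous_real continuous_on_subset[OF \<phi>c] sub)
      ultimately have "((\<lambda>v. \<eta> v + \<phi> v) has_integral integral {s..t} \<eta> + integral {s..t} \<phi>) {s..t}"
        by (intro has_integral_add integrable_integral)
      moreover have "((\<lambda>v. \<eta> v + \<phi> v) has_integral (x t - w t) - (x s - w s)) {s..t}"
        using t x w sub
        by (intro fundamental_theorem_of_calculus[of s t "\<lambda>v. x v - w v"])
          (auto simp: \<eta>_def \<phi>_def intro!: derivative_eq_intros has_vector_derivative_within_subset[OF _ sub])
      ultimately have "x t - w t = integral {s..t} \<eta> + integral {s..t} \<phi>"
        using xw by (auto dest: has_integral_unique)
      moreover have "norm (integral {s..t} \<eta>) \<le> integral {s..t} (\<lambda>v. L * norm (x v - w v))"
      proof (rule integral_norm_bound_integral)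
        show "(\<lambda>v. L * norm (x v - w v)) integrable_on {s..t}"
          by (intro integrable_continuous_real continuous_intros
            continuous_on_subset[OF cx] continuous_on_subset[OF cw] sub)
        fix v assume v: "v \<in> {s..t}"
        show "norm (\<eta> v) \<le> L * norm (x v - w v)"
        \<comment> \<open>At equal slow times \<open>Flip\<close> applies with every positive error,
          so the error can be sent to 0.\<close>
        proof (rule field_le_epsilon)
          fix e' :: real assume "0 < e'"
          from Flip[OF this] v s \<epsilon> show "norm (\<eta> v) \<le> L * norm (x v - w v) + e'"
            unfolding \<eta>_def by (fastforce simp: add.commute)
        qed
      qed fact
      ultimately show "norm (x t - w t) \<le> \<kappa> + L * integral {s..t} (\<lambda>v. norm (x v - w v))"
        using perturb[OF t] norm_triangle_ineq[of "integral {s..t} \<eta>" "integral {s..t} \<phi>"] by simp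
    qed (use L in auto)
    also have "\<dots> \<le> \<kappa> * exp (L * T)" using t L pos by simp
    finally show "norm (x t - w t) \<le> \<delta>" by (simp add: \<kappa>_def)
  qed
qed

section \<open>Moduli of continuity, time means, neighbourhoods and the cutoff\<close>

lemma modulus_of_continuity_less:
  assumes "modulus_of_continuity \<theta>" "e > 0"
  shows "\<exists>\<delta>>0. \<forall>h. 0 \<le> h \<and> h < \<delta> \<longrightarrow> \<theta> h < ennreal e"
proof -
  have "(\<theta> \<longlongrightarrow> 0) (at_right 0)" and mono: "mono_on {0..} \<theta>"
    using assms by (auto simp: modulus_of_continuity_def)
  from order_tendstoD(2)[OF this(1), of "ennreal e"] assms
  have "\<forall>\<^sub>F h in at_right 0. \<theta> h < ennreal e" by (simp add: zero_less_iff_neq_zero)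
  then obtain \<delta> where \<delta>: "\<delta> > 0" "\<And>h. 0 < h \<Longrightarrow> h < \<delta> \<Longrightarrow> \<theta> h < ennreal e"
    unfolding eventually_at_right_field by blast
  have "\<theta> h < ennreal e" if h: "0 \<le> h" "h < \<delta>" for h
  proof -
    \<comment> \<open>The limit from the right says nothing about \<open>\<theta> 0\<close>;
      monotonicity bounds it by the value at a positive \<open>h'\<close>.\<close>
    obtain h' where h': "h < h'" "h' < \<delta>" using dense[OF h(2)] by blast
    have "\<theta> h \<le> \<theta> h'" using h' h by (intro mono_onD[OF mono]) auto
    also have "\<dots> < ennreal e" using h' h by (intro \<delta>(2)) auto
    finally show ?thesis .
  qed
  with \<delta>(1) show ?thesis by blast
qed

lemma norm_time_mean_le:
  assumes "T > 0" "continuous_on {\<tau>..T + \<tau>} (\<lambda>s. f s t x)" "\<And>s. s \<in> {\<tau>..T + \<tau>} \<Longrightarrow> norm (f s t x) \<le> C"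
  shows "norm (time_mean f T \<tau> t x) \<le> C"
  using integral_bound[of \<tau> "T + \<tau>" "\<lambda>s. f s t x" C] assms by (simp add: time_mean_def field_simps)

lemma norm_time_mean_diff_le:
  assumes T: "T > 0" and cont: "continuous_on {\<tau>..T + \<tau>} (\<lambda>s. f s t x)" "continuous_on {\<tau>..T + \<tau>} (\<lambda>s. f s t' x')"
    and C: "\<And>s. s \<in> {\<tau>..T + \<tau>} \<Longrightarrow> norm (f s t x - f s t' x') \<le> C"
  shows "norm (time_mean f T \<tau> t x - time_mean f T \<tau> t' x') \<le> C"
proof -
  have "time_mean f T \<tau> t x - time_mean f T \<tau> t' x' = (1 / T) *\<^sub>R integral {\<tau>..T + \<tau>} (\<lambda>s. f s t x - f s t' x')"
    using cont by (simp add: time_mean_def integral_diff integrable_continuous_real scaleR_diff_right)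
  moreover have "norm (integral {\<tau>..T + \<tau>} (\<lambda>s. f s t x - f s t' x')) \<le> C * (T + \<tau> - \<tau>)"
    using T cont C by (intro integral_bound continuous_intros) auto
  ultimately show ?thesis using T by (simp add: field_simps)
qed

text \<open>A point at distance exactly \<mu> is the limit of points on the segment towards a
  nearest point of \<open>C\<close>, and these are strictly closer. This connects the hypothesis on
  \<open>xhat\<close> with the closure in \<open>closed_nbhd\<close>.\<close>

lemma closed_nbhd_memI:
  fixes x :: "'a::euclidean_space"
  assumes "infdist x C \<le> \<mu>" "\<mu> > 0" "closed C" "C \<noteq> {}"
  shows "x \<in> closed_nbhd \<mu> C"
proof -
  obtain c where c: "c \<in> C" "infdist x C = dist x c"
    using infdist_attains_inf[OF assms(3,4)] by blast
  define p where "p = (\<lambda>n. x + (1 / real (Suc n)) *\<^sub>R (c - x))"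
  have "infdist (p n) C < \<mu>" for n
  proof -
    have "infdist (p n) C \<le> dist (p n) c" by (rule infdist_le[OF c(1)])
    also have "p n - c = (1 - 1 / real (Suc n)) *\<^sub>R (x - c)"
      by (simp add: p_def algebra_simps)
    then have "dist (p n) c = (1 - 1 / real (Suc n)) * dist x c"
      by (simp add: dist_norm)
    also have "\<dots> \<le> (1 - 1 / real (Suc n)) * \<mu>"
      using c assms by (intro mult_left_mono) auto
    also have "\<dots> < 1 * \<mu>" using assms by (intro mult_strict_right_mono) auto
    finally show ?thesis by simp
  qed
  moreover have "p \<longlonglongrightarrow> x + 0 *\<^sub>R (c - x)"
    unfolding p_def by (intro tendsto_intros LIMSEQ_Suc[OF lim_1_over_n])
  ultimately show ?thesis
    unfolding closed_nbhd_def closure_sequential by auto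
qed

text \<open>Composing with \<open>cutoff r\<close> makes a field globally bounded and Lipschitz without changing
  its solutions as long as they stay in the ball of radius \<open>r\<close>.\<close>

definition cutoff :: "real \<Rightarrow> 'a::euclidean_space \<Rightarrow> 'a" where
  "cutoff r x = closest_point (cball 0 r) x"

lemma norm_cutoff_le: "r > 0 \<Longrightarrow> norm (cutoff r x) \<le> r"
  using closest_point_in_set[of "cball 0 r" x] by (simp add: cutoff_def)

lemma cutoff_eq: "norm x \<le> r \<Longrightarrow> cutoff r x = x"
  by (simp add: cutoff_def closest_point_self)

lemma norm_cutoff_diff_le: "r > 0 \<Longrightarrow> norm (cutoff r x - cutoff r y) \<le> norm (x - y)"
  using closest_point_lipschitz[of "cball 0 r" x y] by (simp add: cutoff_def dist_norm)

lemma continuous_on_cutoff: "r > 0 \<Longrightarrow> continuous_on S (cutoff r)"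
  using continuous_on_closest_point[of "cball 0 r" S] by (simp add: cutoff_def[abs_def])

section \<open>The field and its average on balls\<close>

locale averaging_problem =
  fixes f :: "real \<Rightarrow> real \<Rightarrow> 'a::euclidean_space \<Rightarrow> 'a"
  assumes bounded_continuous: "\<And>r::real. r > 0 \<Longrightarrow>
      bounded ((\<lambda>(\<tau>, t, x). f \<tau> t x) ` ({0..} \<times> {0..} \<times> {x. norm x \<le> r})) \<and>
      continuous_on ({0..} \<times> {0..} \<times> {x. norm x \<le> r}) (\<lambda>(\<tau>, t, x). f \<tau> t x)"
    and modulus: "\<And>r::real. r > 0 \<Longrightarrow>
      \<exists>\<theta> L. modulus_of_continuity \<theta> \<and> L > 0 \<and>
        (\<forall>\<tau>\<ge>0. \<forall>t1\<ge>0. \<forall>t2\<ge>0. \<forall>x1 x2. norm x1 \<le> r \<and> norm x2 \<le> r \<longrightarrow>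
          ennreal (norm (f \<tau> t1 x1 - f \<tau> t2 x2))
            \<le> \<theta> \<bar>t1 - t2\<bar> + ennreal (L * norm (x1 - x2)))"
    and mean_converges: "\<And>t x. t \<ge> 0 \<Longrightarrow> \<exists>l. ((\<lambda>T. time_mean f T 0 t x) \<longlongrightarrow> l) at_top"
    and mean_uniform: "\<And>r::real. r > 0 \<Longrightarrow>
      uniform_limit ({0..} \<times> {0..} \<times> {x. norm x \<le> r})
        (\<lambda>T (\<tau>, t, x). time_mean f T \<tau> t x) (\<lambda>(\<tau>, t, x). averaged f t x) at_top"
begin

lemma mean_tendsto_averaged:
  "t \<ge> 0 \<Longrightarrow> ((\<lambda>T. time_mean f T 0 t x) \<longlongrightarrow> averaged f t x) at_top"
  using mean_converges[of t x] tendsto_Lim[OF trivial_limit_at_top_linorder]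
  unfolding averaged_def by metis

lemma continuous_on_field:
  assumes "continuous_on S \<alpha>" "continuous_on S \<beta>" "continuous_on S \<xi>"
    and "\<And>s. s \<in> S \<Longrightarrow> \<alpha> s \<ge> 0" "\<And>s. s \<in> S \<Longrightarrow> \<beta> s \<ge> 0" "\<And>s. s \<in> S \<Longrightarrow> norm (\<xi> s) \<le> r" "r > 0"
  shows "continuous_on S (\<lambda>s. f (\<alpha> s) (\<beta> s) (\<xi> s))"
proof -
  have "continuous_on S ((\<lambda>(\<tau>, t, x). f \<tau> t x) \<circ> (\<lambda>s. (\<alpha> s, \<beta> s, \<xi> s)))"
    using assms bounded_continuous[of r]
    by (intro continuous_on_compose continuous_intros) (auto intro: continuous_on_subset)
  then show ?thesis by (simp add: o_def)
qed

lemma continuous_on_field_fast: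
  assumes "\<tau> \<ge> 0" "t \<ge> 0" shows "continuous_on {\<tau>..T} (\<lambda>s. f s t x)"
  \<comment> \<open>The radius must be positive, and \<open>norm x\<close> may be 0.\<close>
  using assms by (intro continuous_on_field[where r = "norm x + 1"] continuous_intros)
    (auto intro: add_nonneg_pos)

text \<open>Time means inherit the bounds of \<open>f\<close> with the same constants, and these
  survive the limit, so \<open>M\<close>, \<open>L\<close> and each \<delta> serve \<open>f\<close>
  and \<open>averaged f\<close> alike. The modulus may take the value infinity, so it is replaced by
  a real-valued e-\<delta> form.\<close>

lemma field_constants:
  assumes r: "r > 0"
  obtains M L where "M > 0" "L > 0"
    and "\<And>\<tau> t x. \<tau> \<ge> 0 \<Longrightarrow> t \<ge> 0 \<Longrightarrow> norm x \<le> r \<Longrightarrow> norm (f \<tau> t x) \<le> M"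
    and "\<And>t x. t \<ge> 0 \<Longrightarrow> norm x \<le> r \<Longrightarrow> norm (averaged f t x) \<le> M"
    and "\<And>e::real. e > 0 \<Longrightarrow> \<exists>\<delta>>0. \<forall>\<tau>\<ge>0. \<forall>t1\<ge>0. \<forall>t2\<ge>0. \<forall>x1 x2. \<bar>t1 - t2\<bar> < \<delta> \<and> norm x1 \<le> r \<and> norm x2 \<le> r \<longrightarrow>
      norm (f \<tau> t1 x1 - f \<tau> t2 x2) \<le> e + L * norm (x1 - x2)"
    and "\<And>e::real. e > 0 \<Longrightarrow> \<exists>\<delta>>0. \<forall>t1\<ge>0. \<forall>t2\<ge>0. \<forall>x1 x2. \<bar>t1 - t2\<bar> < \<delta> \<and> norm x1 \<le> r \<and> norm x2 \<le> r \<longrightarrow>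
      norm (averaged f t1 x1 - averaged f t2 x2) \<le> e + L * norm (x1 - x2)"
proof -
  obtain M where M: "M > 0" "\<And>y. y \<in> (\<lambda>(\<tau>, t, x). f \<tau> t x) ` ({0..} \<times> {0..} \<times> {x. norm x \<le> r}) \<Longrightarrow> norm y \<le> M"
    using bounded_continuous[OF r] unfolding bounded_pos by blast
  have fM: "norm (f \<tau> t x) \<le> M" if "\<tau> \<ge> 0" "t \<ge> 0" "norm x \<le> r" for \<tau> t x
    by (rule M(2), rule image_eqI[of _ _ "(\<tau>, t, x)"]) (use that in auto)
  obtain \<theta> L where \<theta>: "modulus_of_continuity \<theta>" and L: "L > 0"
    and lip: "\<And>\<tau> t1 t2 x1 x2. \<tau> \<ge> 0 \<Longrightarrow> t1 \<ge> 0 \<Longrightarrow> t2 \<ge> 0 \<Longrightarrow> norm x1 \<le> r \<Longrightarrow> norm x2 \<le> r \<Longrightarrow>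
          ennreal (norm (f \<tau> t1 x1 - f \<tau> t2 x2)) \<le> \<theta> \<bar>t1 - t2\<bar> + ennreal (L * norm (x1 - x2))"
    using modulus[OF r] by metis
  have T1: "\<forall>\<^sub>F T::real in at_top. T > 0" by (rule eventually_gt_at_top)
  have avM: "norm (averaged f t x) \<le> M" if "t \<ge> 0" "norm x \<le> r" for t x
    by (rule Lim_norm_ubound[OF _ mean_tendsto_averaged[OF that(1)]], simp, rule eventually_mono[OF T1])
      (use that fM in \<open>auto intro!: norm_time_mean_le continuous_on_field_fast\<close>)
  have equi: "\<exists>\<delta>>0. \<forall>t1\<ge>0. \<forall>t2\<ge>0. \<forall>x1 x2. \<bar>t1 - t2\<bar> < \<delta> \<and> norm x1 \<le> r \<and> norm x2 \<le> r \<longrightarrow>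
      (\<forall>\<tau>\<ge>0. norm (f \<tau> t1 x1 - f \<tau> t2 x2) \<le> e + L * norm (x1 - x2)) \<and>
      norm (averaged f t1 x1 - averaged f t2 x2) \<le> e + L * norm (x1 - x2)" if e: "e > 0" for e
  proof -
    obtain \<delta> where \<delta>: "\<delta> > 0" "\<And>h. 0 \<le> h \<Longrightarrow> h < \<delta> \<Longrightarrow> \<theta> h < ennreal e"
      using modulus_of_continuity_less[OF \<theta> e] by blast
    have fe: "norm (f \<tau> t1 x1 - f \<tau> t2 x2) \<le> e + L * norm (x1 - x2)"
      if "\<tau> \<ge> 0" "t1 \<ge> 0" "t2 \<ge> 0" "norm x1 \<le> r" "norm x2 \<le> r" "\<bar>t1 - t2\<bar> < \<delta>" for \<tau> t1 t2 x1 x2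
    proof -
      have "ennreal (norm (f \<tau> t1 x1 - f \<tau> t2 x2)) \<le> ennreal e + ennreal (L * norm (x1 - x2))"
        using lip[OF that(1-5)] \<delta>(2)[of "\<bar>t1 - t2\<bar>"] that(6)
        by (meson abs_ge_zero add_right_mono less_imp_le order_trans)
      also have "\<dots> = ennreal (e + L * norm (x1 - x2))" using e L by simp
      finally show ?thesis using e L by (subst (asm) ennreal_le_iff) auto
    qed
    have "norm (averaged f t1 x1 - averaged f t2 x2) \<le> e + L * norm (x1 - x2)"
      if "t1 \<ge> 0" "t2 \<ge> 0" "norm x1 \<le> r" "norm x2 \<le> r" "\<bar>t1 - t2\<bar> < \<delta>" for t1 t2 x1 x2
      by (rule Lim_norm_ubound[OF _ tendsto_diff[OF mean_tendsto_averaged[OF that(1)] mean_tendsto_averaged[OF that(2)]]],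
          simp, rule eventually_mono[OF T1])
        (use that fe in \<open>auto intro!: norm_time_mean_diff_le continuous_on_field_fast\<close>)
    with fe \<delta>(1) show ?thesis by blast
  qed
  show ?thesis
  proof (rule that[OF M(1) L fM avM])
    show "\<exists>\<delta>>0. \<forall>\<tau>\<ge>0. \<forall>t1\<ge>0. \<forall>t2\<ge>0. \<forall>x1 x2. \<bar>t1 - t2\<bar> < \<delta> \<and> norm x1 \<le> r \<and> norm x2 \<le> r \<longrightarrow>
      norm (f \<tau> t1 x1 - f \<tau> t2 x2) \<le> e + L * norm (x1 - x2)" if "e > 0" for e
      using equi[OF that] by meson
    show "\<exists>\<delta>>0. \<forall>t1\<ge>0. \<forall>t2\<ge>0. \<forall>x1 x2. \<bar>t1 - t2\<bar> < \<delta> \<and> norm x1 \<le> r \<and> norm x2 \<le> r \<longrightarrow>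
      norm (averaged f t1 x1 - averaged f t2 x2) \<le> e + L * norm (x1 - x2)" if "e > 0" for e
      using equi[OF that] by meson
  qed
qed

text \<open>At equal slow times the estimates of \<open>field_constants\<close> hold for every
  \<open>e\<close>, which can then tend to 0.\<close>

lemma lipschitz_constant:
  assumes r: "r > 0"
  obtains L where "L > 0"
    and "\<And>\<tau> t x y. \<tau> \<ge> 0 \<Longrightarrow> t \<ge> 0 \<Longrightarrow> norm x \<le> r \<Longrightarrow> norm y \<le> r \<Longrightarrow> norm (f \<tau> t x - f \<tau> t y) \<le> L * norm (x - y)"
    and "\<And>t x y. t \<ge> 0 \<Longrightarrow> norm x \<le> r \<Longrightarrow> norm y \<le> r \<Longrightarrow>
      norm (averaged f t x - averaged f t y) \<le> L * norm (x - y)"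
proof (rule field_constants[OF r])
  fix M L
  assume L: "L > 0"
    and f: "\<And>e::real. e > 0 \<Longrightarrow> \<exists>\<delta>>0. \<forall>\<tau>\<ge>0. \<forall>t1\<ge>0. \<forall>t2\<ge>0. \<forall>x1 x2. \<bar>t1 - t2\<bar> < \<delta> \<and> norm x1 \<le> r \<and> norm x2 \<le> r \<longrightarrow>
      norm (f \<tau> t1 x1 - f \<tau> t2 x2) \<le> e + L * norm (x1 - x2)"
    and av: "\<And>e::real. e > 0 \<Longrightarrow> \<exists>\<delta>>0. \<forall>t1\<ge>0. \<forall>t2\<ge>0. \<forall>x1 x2. \<bar>t1 - t2\<bar> < \<delta> \<and> norm x1 \<le> r \<and> norm x2 \<le> r \<longrightarrow>
      norm (averaged f t1 x1 - averaged f t2 x2) \<le> e + L * norm (x1 - x2)"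
  show thesis
  proof (rule that[OF L])
    show "norm (f \<tau> t x - f \<tau> t y) \<le> L * norm (x - y)"
      if "\<tau> \<ge> 0" "t \<ge> 0" "norm x \<le> r" "norm y \<le> r" for \<tau> t x y
      by (rule field_le_epsilon) (use f that in \<open>fastforce simp: add.commute\<close>)
    show "norm (averaged f t x - averaged f t y) \<le> L * norm (x - y)"
      if "t \<ge> 0" "norm x \<le> r" "norm y \<le> r" for t x y
      by (rule field_le_epsilon) (use av that in \<open>fastforce simp: add.commute\<close>)
  qed
qed

lemma lipschitz_on_balls_averaged: "lipschitz_on_balls (averaged f)"
  unfolding lipschitz_on_balls_def using lipschitz_constant by (metis less_imp_le)

lemma lipschitz_on_balls_slow:
  assumes "\<epsilon> > 0" shows "lipschitz_on_balls (\<lambda>t x. f (t / \<epsilon>) t x)"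
  unfolding lipschitz_on_balls_def
proof (intro allI impI)
  fix r :: real assume "r > 0"
  then show "\<exists>L\<ge>0. \<forall>t\<ge>0. \<forall>x y. norm x \<le> r \<and> norm y \<le> r \<longrightarrow>
      norm (f (t / \<epsilon>) t x - f (t / \<epsilon>) t y) \<le> L * norm (x - y)"
    using assms by (rule_tac lipschitz_constant[of r]) (auto intro: less_imp_le)
qed

lemma lipschitz_on_balls_fast:
  assumes "\<epsilon> > 0" shows "lipschitz_on_balls (\<lambda>\<tau> x. \<epsilon> *\<^sub>R f \<tau> (\<epsilon> * \<tau>) x)"
  unfolding lipschitz_on_balls_def
proof (intro allI impI)
  fix r :: real assume "r > 0"
  then obtain L where L: "L > 0"
    "\<And>\<tau> t x y. \<tau> \<ge> 0 \<Longrightarrow> t \<ge> 0 \<Longrightarrow> norm x \<le> r \<Longrightarrow> norm y \<le> r \<Longrightarrow> norm (f \<tau> t x - f \<tau> t y) \<le> L * norm (x - y)"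
    using lipschitz_constant by metis
  show "\<exists>L\<ge>0. \<forall>\<tau>\<ge>0. \<forall>x y. norm x \<le> r \<and> norm y \<le> r \<longrightarrow>
      norm (\<epsilon> *\<^sub>R f \<tau> (\<epsilon> * \<tau>) x - \<epsilon> *\<^sub>R f \<tau> (\<epsilon> * \<tau>) y) \<le> L * norm (x - y)"
    using L assms
    by (intro exI[of _ "\<epsilon> * L"]) (simp add: scaleR_diff_right[symmetric] mult.assoc)
qed

text \<open>Continuity of the average is not among the hypotheses. It comes from the joint estimate
  in slow time and state, which passes from \<open>f\<close> to the limit of its means.\<close>

lemma continuous_on_averaged_cutoff:
  assumes r: "r > 0"
  shows "continuous_on ({0..} \<times> UNIV) (\<lambda>(t, x). averaged f t (cutoff r x))"
proof (rule field_constants[OF r])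
  fix M L
  assume L: "L > 0"
    and av: "\<And>e::real. e > 0 \<Longrightarrow> \<exists>\<delta>>0. \<forall>t1\<ge>0. \<forall>t2\<ge>0. \<forall>x1 x2. \<bar>t1 - t2\<bar> < \<delta> \<and> norm x1 \<le> r \<and> norm x2 \<le> r \<longrightarrow>
      norm (averaged f t1 x1 - averaged f t2 x2) \<le> e + L * norm (x1 - x2)"
  show ?thesis
    unfolding continuous_on_iff
  proof (intro ballI allI impI)
    fix p :: "real \<times> 'a" and e :: real assume p: "p \<in> {0..} \<times> UNIV" and e: "e > 0"
    obtain t x where tx: "p = (t, x)" by (cases p)
    obtain \<delta> where \<delta>: "\<delta> > 0" "\<And>t1 t2 x1 x2. t1 \<ge> 0 \<Longrightarrow> t2 \<ge> 0 \<Longrightarrow> \<bar>t1 - t2\<bar> < \<delta> \<Longrightarrow> norm x1 \<le> r \<Longrightarrow> norm x2 \<le> r \<Longrightarrow>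
      norm (averaged f t1 x1 - averaged f t2 x2) \<le> e / 2 + L * norm (x1 - x2)"
      using av[of "e / 2"] e by (metis half_gt_zero)
    show "\<exists>d>0. \<forall>q\<in>{0..} \<times> UNIV. dist q p < d \<longrightarrow>
      dist (case q of (t, x) \<Rightarrow> averaged f t (cutoff r x)) (case p of (t, x) \<Rightarrow> averaged f t (cutoff r x)) < e"
    proof (intro exI[of _ "min \<delta> (e / (2 * L))"] conjI ballI impI)
      show "0 < min \<delta> (e / (2 * L))" using \<delta> e L by simp
      fix q :: "real \<times> 'a" assume q: "q \<in> {0..} \<times> UNIV" "dist q p < min \<delta> (e / (2 * L))"
      obtain t' x' where q': "q = (t', x')" by (cases q)
      have "\<bar>t' - t\<bar> < \<delta>" "norm (x' - x) < e / (2 * L)"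
        using q dist_fst_le[of q p] dist_snd_le[of q p] by (auto simp: q' tx dist_norm)
      then have "L * norm (cutoff r x' - cutoff r x) < e / 2"
        using norm_cutoff_diff_le[OF r, of x' x] L by (simp add: field_simps) (smt (verit) mult_left_mono)
      moreover have "norm (averaged f t' (cutoff r x') - averaged f t (cutoff r x)) \<le> e / 2 + L * norm (cutoff r x' - cutoff r x)"
        using p q \<open>\<bar>t' - t\<bar> < \<delta>\<close> by (intro \<delta>(2) norm_cutoff_le r) (auto simp: q' tx)
      ultimately show "dist (case q of (t, x) \<Rightarrow> averaged f t (cutoff r x)) (case p of (t, x) \<Rightarrow> averaged f t (cutoff r x)) < e"
        by (simp add: q' tx dist_norm)
    qed
  qed
qed

lemma continuous_on_field_cutoff:
  assumes r: "r > 0"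
  shows "continuous_on ({0..} \<times> {0..} \<times> UNIV) (\<lambda>(\<tau>, t, x). f \<tau> t (cutoff r x))"
  unfolding case_prod_unfold
  using r by (intro continuous_on_field[where r = r] continuous_intros
      continuous_on_compose2[OF continuous_on_cutoff[OF r, of UNIV]] norm_cutoff_le) auto

section \<open>Solutions of the cut-off equations\<close>

lemma exists_averaged_cutoff_solution:
  assumes r: "r > 0" and s: "s \<ge> 0"
  shows "\<exists>w. w s = x0 \<and> (\<forall>t\<ge>s. (w has_vector_derivative averaged f t (cutoff r (w t))) (at t within {s..}))"
proof (rule field_constants[OF r], rule lipschitz_constant[OF r])
  fix M L
  assume M: "\<And>t x. t \<ge> 0 \<Longrightarrow> norm x \<le> r \<Longrightarrow> norm (averaged f t x) \<le> M" and L: "L > 0"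
    "\<And>t x y. t \<ge> 0 \<Longrightarrow> norm x \<le> r \<Longrightarrow> norm y \<le> r \<Longrightarrow>
      norm (averaged f t x - averaged f t y) \<le> L * norm (x - y)"
  show ?thesis
  proof (rule exists_global_solution[OF _ _ _ L(1)])
    show "continuous_on ({s..} \<times> UNIV) (\<lambda>(t, x). averaged f t (cutoff r x))"
      using s by (intro continuous_on_subset[OF continuous_on_averaged_cutoff[OF r]]) auto
    show "norm (averaged f t (cutoff r x)) \<le> M" if "t \<ge> s" for t x
      using that s r by (intro M norm_cutoff_le) auto
    show "norm (averaged f t (cutoff r x) - averaged f t (cutoff r y)) \<le> L * norm (x - y)" if "t \<ge> s" for t x y
    proof -
      have "norm (averaged f t (cutoff r x) - averaged f t (cutoff r y)) \<le> L * norm (cutoff r x - cutoff r y)"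
        using that s r by (intro L norm_cutoff_le) auto
      also have "\<dots> \<le> L * norm (x - y)" using L r by (intro mult_left_mono norm_cutoff_diff_le) auto
      finally show ?thesis .
    qed
  qed
qed

text \<open>Provides the candidate for the fast solution before anything is known about global
  existence.\<close>

lemma exists_slow_cutoff_solution:
  assumes r: "r > 0" and \<epsilon>: "\<epsilon> > 0"
  shows "\<exists>x. x 0 = x0 \<and> (\<forall>t\<ge>0. (x has_vector_derivative f (t / \<epsilon>) t (cutoff r (x t))) (at t within {0..}))"
proof (rule field_constants[OF r], rule lipschitz_constant[OF r])
  fix M L
  assume M: "\<And>\<tau> t x. \<tau> \<ge> 0 \<Longrightarrow> t \<ge> 0 \<Longrightarrow> norm x \<le> r \<Longrightarrow> norm (f \<tau> t x) \<le> M" and L: "L > 0"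
    "\<And>\<tau> t x y. \<tau> \<ge> 0 \<Longrightarrow> t \<ge> 0 \<Longrightarrow> norm x \<le> r \<Longrightarrow> norm y \<le> r \<Longrightarrow> norm (f \<tau> t x - f \<tau> t y) \<le> L * norm (x - y)"
  show ?thesis
  proof (rule exists_global_solution[OF _ _ _ L(1)])
    show "continuous_on ({0..} \<times> UNIV) (\<lambda>(t, x). f (t / \<epsilon>) t (cutoff r x))"
      unfolding case_prod_unfold
      using r \<epsilon> by (intro continuous_on_field[where r = r] continuous_intros
          continuous_on_compose2[OF continuous_on_cutoff[OF r, of UNIV]] norm_cutoff_le) auto
    show "norm (f (t / \<epsilon>) t (cutoff r x)) \<le> M" if "t \<ge> 0" for t x
      using that \<epsilon> r by (intro M norm_cutoff_le) auto
    show "norm (f (t / \<epsilon>) t (cutoff r x) - f (t / \<epsilon>) t (cutoff r y)) \<le> L * norm (x - y)" if "t \<ge> 0" for t x y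
    proof -
      have "norm (f (t / \<epsilon>) t (cutoff r x) - f (t / \<epsilon>) t (cutoff r y)) \<le> L * norm (cutoff r x - cutoff r y)"
        using that \<epsilon> r by (intro L norm_cutoff_le) auto
      also have "\<dots> \<le> L * norm (x - y)" using L r by (intro mult_left_mono norm_cutoff_diff_le) auto
      finally show ?thesis .
    qed
  qed
qed

lemma averaging_cutoff:
  assumes r: "r > 0" and \<delta>: "\<delta> > 0" and T: "T > 0"
  obtains \<epsilon>0 where "\<epsilon>0 > 0"
    and "\<And>\<epsilon> s x w t. 0 < \<epsilon> \<Longrightarrow> \<epsilon> < \<epsilon>0 \<Longrightarrow> 0 \<le> s \<Longrightarrow> x s = w s \<Longrightarrow>
      (\<And>t. t \<in> {s..s + T} \<Longrightarrow> (x has_vector_derivative f (t / \<epsilon>) t (cutoff r (x t))) (at t within {s..s + T})) \<Longrightarrow>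
      (\<And>t. t \<in> {s..s + T} \<Longrightarrow> (w has_vector_derivative averaged f t (cutoff r (w t))) (at t within {s..s + T})) \<Longrightarrow>
      t \<in> {s..s + T} \<Longrightarrow> norm (x t - w t) \<le> \<delta>"
proof (rule field_constants[OF r])
  fix M L
  assume M: "M > 0" and L: "L > 0"
    and fM: "\<And>\<tau> t x. \<tau> \<ge> 0 \<Longrightarrow> t \<ge> 0 \<Longrightarrow> norm x \<le> r \<Longrightarrow> norm (f \<tau> t x) \<le> M"
    and avM: "\<And>t x. t \<ge> 0 \<Longrightarrow> norm x \<le> r \<Longrightarrow> norm (averaged f t x) \<le> M"
    and fe: "\<And>e::real. e > 0 \<Longrightarrow> \<exists>\<delta>>0. \<forall>\<tau>\<ge>0. \<forall>t1\<ge>0. \<forall>t2\<ge>0. \<forall>x1 x2. \<bar>t1 - t2\<bar> < \<delta> \<and> norm x1 \<le> r \<and> norm x2 \<le> r \<longrightarrow>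
      norm (f \<tau> t1 x1 - f \<tau> t2 x2) \<le> e + L * norm (x1 - x2)"
    and ave: "\<And>e::real. e > 0 \<Longrightarrow> \<exists>\<delta>>0. \<forall>t1\<ge>0. \<forall>t2\<ge>0. \<forall>x1 x2. \<bar>t1 - t2\<bar> < \<delta> \<and> norm x1 \<le> r \<and> norm x2 \<le> r \<longrightarrow>
      norm (averaged f t1 x1 - averaged f t2 x2) \<le> e + L * norm (x1 - x2)"
  have cut: "e + L * norm (cutoff r x1 - cutoff r x2) \<le> e + L * norm (x1 - x2)" for e x1 x2
    using L norm_cutoff_diff_le[OF r, of x1 x2] by simp
  show thesis
  proof (rule averaging_finite_time[of "\<lambda>\<tau> t x. f \<tau> t (cutoff r x)" "\<lambda>t x. averaged f t (cutoff r x)" M L \<delta> T])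
    show "\<exists>\<delta>>0. \<forall>\<tau>\<ge>0. \<forall>t1\<ge>0. \<forall>t2\<ge>0. \<forall>x1 x2. \<bar>t1 - t2\<bar> < \<delta> \<longrightarrow>
      norm (f \<tau> t1 (cutoff r x1) - f \<tau> t2 (cutoff r x2)) \<le> e + L * norm (x1 - x2)" if "e > 0" for e
      using fe[OF that] cut[of e] norm_cutoff_le[OF r] by (meson order_trans)
    show "\<exists>\<delta>>0. \<forall>t1\<ge>0. \<forall>t2\<ge>0. \<forall>x1 x2. \<bar>t1 - t2\<bar> < \<delta> \<longrightarrow>
      norm (averaged f t1 (cutoff r x1) - averaged f t2 (cutoff r x2)) \<le> e + L * norm (x1 - x2)" if "e > 0" for e
      using ave[OF that] cut[of e] norm_cutoff_le[OF r] by (meson order_trans)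
    show "\<exists>T0. \<forall>T\<ge>T0. \<forall>\<tau>\<ge>0. \<forall>t\<ge>0. \<forall>x.
      norm (time_mean (\<lambda>\<tau> t x. f \<tau> t (cutoff r x)) T \<tau> t x - averaged f t (cutoff r x)) \<le> e" if e: "e > 0" for e
    proof -
      obtain T0 where T0: "\<And>T \<tau> t x. T \<ge> T0 \<Longrightarrow> \<tau> \<ge> 0 \<Longrightarrow> t \<ge> 0 \<Longrightarrow> norm x \<le> r \<Longrightarrow>
          dist (time_mean f T \<tau> t x) (averaged f t x) < e"
        using uniform_limitD[OF mean_uniform[OF r] e] unfolding eventually_at_top_linorder by fastforce
      \<comment> \<open>The state is constant inside a mean, so the cutoff only moves it into the
        ball, where the convergence is uniform.\<close>
      have "time_mean (\<lambda>\<tau> t x. f \<tau> t (cutoff r x)) T \<tau> t x = time_mean f T \<tau> t (cutoff r x)" for T \<tau> t x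
        by (simp add: time_mean_def)
      then show ?thesis using T0 norm_cutoff_le[OF r] by (metis dist_norm less_imp_le)
    qed
  qed (use that in \<open>auto intro!: continuous_on_field_cutoff continuous_on_averaged_cutoff fM avM norm_cutoff_le r M L \<delta> T\<close>)
qed

end

section \<open>Stability of the attractor and global averaging\<close>

locale averaging_attractor = averaging_problem f
  for f :: "real \<Rightarrow> real \<Rightarrow> 'a::euclidean_space \<Rightarrow> 'a" +
  fixes K :: "real \<Rightarrow> 'a set" and \<mu> k :: real
  assumes attractor: "uniform_local_attractor (averaged f) K \<mu>"
    and k: "k > 0" "(\<Union>t\<in>{0..}. K t) \<subseteq> {x. norm x < k}"
begin

definition flow :: "real \<Rightarrow> 'a \<Rightarrow> real \<Rightarrow> 'a" where
  "flow s x t = the (max_sol (averaged f) s x t)"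

lemma \<mu>_pos: "\<mu> > 0"
  using attractor by (simp add: uniform_local_attractor_def)

lemma K_closed: "t \<ge> 0 \<Longrightarrow> closed (K t)" and K_nonempty: "t \<ge> 0 \<Longrightarrow> K t \<noteq> {}"
  using attractor by (auto simp: uniform_local_attractor_def compact_imp_closed)

lemma norm_le_of_infdist_K:
  assumes "t \<ge> 0" "infdist y (K t) \<le> d"
  shows "norm y \<le> k + d"
proof -
  obtain c where c: "c \<in> K t" "infdist y (K t) = dist y c"
    using infdist_attains_inf[OF K_closed K_nonempty] assms(1) by blast
  moreover have "norm c < k" using c k(2) assms(1) by auto
  moreover have "norm y \<le> norm c + dist y c" by (simp add: dist_norm norm_triangle_sub)
  ultimately show ?thesis using assms(2) by simp
qed

lemma nbhd_memI: "s \<ge> 0 \<Longrightarrow> infdist x (K s) \<le> \<mu> \<Longrightarrow> x \<in> closed_nbhd \<mu> (K s)"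
  by (intro closed_nbhd_memI \<mu>_pos K_closed K_nonempty)

lemma flow_exists:
  assumes "s \<ge> 0" "x \<in> closed_nbhd \<mu> (K s)"
  shows "{s..} \<subseteq> dom (max_sol (averaged f) s x)"
proof
  fix t assume "t \<in> {s..}"
  then show "t \<in> dom (max_sol (averaged f) s x)"
    using assms attractor unfolding uniform_local_attractor_def by (meson atLeast_iff)
qed

lemma flow_initial: "s \<ge> 0 \<Longrightarrow> flow s x s = x"
  using max_sol_initial[OF lipschitz_on_balls_averaged, of s x] by (simp add: flow_def)

lemma flow_solution:
  assumes "s \<ge> 0" "x \<in> closed_nbhd \<mu> (K s)" "S \<subseteq> {s..}" "t \<in> S"
  shows "(flow s x has_vector_derivative averaged f t (flow s x t)) (at t within S)"
  unfolding flow_def[abs_def]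
  using ivp_solution_vector_derivative[OF max_sol_greatest(1)[OF lipschitz_on_balls_averaged assms(1)] _ assms(4)]
    flow_exists[OF assms(1,2)] assms(3) by (meson order_trans)

lemma flow_invariant:
  assumes "s \<ge> 0" "c \<in> K s" "t \<ge> s"
  shows "flow s c t \<in> K t"
proof -
  have "c \<in> closed_nbhd \<mu> (K s)" using assms \<mu>_pos by (intro nbhd_memI) auto
  then have "t \<in> dom (max_sol (averaged f) s c)" using flow_exists assms by auto
  then have "max_sol (averaged f) s c t = Some (flow s c t)" by (auto simp: flow_def)
  then have "flow s c t \<in> max_sol_image (averaged f) s (K s) t"
    using assms unfolding max_sol_image_def by blast
  also have "\<dots> = K t" using attractor assms by (simp add: uniform_local_attractor_def)
  finally show ?thesis .
qed

lemma attraction_time: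
  assumes e: "e > 0"
  obtains T where "T > 0"
    and "\<And>s x t. s \<ge> 0 \<Longrightarrow> x \<in> closed_nbhd \<mu> (K s) \<Longrightarrow> t \<ge> s + T \<Longrightarrow> infdist (flow s x t) (K t) \<le> e"
proof -
  have "\<forall>\<^sub>F t in at_top. \<forall>s\<ge>0.
      semidist (max_sol_image (averaged f) s (closed_nbhd \<mu> (K s)) (t + s)) (K (t + s)) < ennreal e"
    using attractor e unfolding uniform_local_attractor_def by blast
  then obtain T0 where T0: "\<And>t s. t \<ge> T0 \<Longrightarrow> s \<ge> 0 \<Longrightarrow>
      semidist (max_sol_image (averaged f) s (closed_nbhd \<mu> (K s)) (t + s)) (K (t + s)) < ennreal e"
    unfolding eventually_at_top_linorder by blast
  show thesis
  \<comment> \<open>The maximum makes the waiting time positive, since it later serves as the length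
    of the blocks.\<close>
  proof (rule that[of "max T0 1"])
    fix s x t assume s: "s \<ge> 0" and x: "x \<in> closed_nbhd \<mu> (K s)" and t: "t \<ge> s + max T0 1"
    have "t \<in> dom (max_sol (averaged f) s x)" using flow_exists[OF s x] t by (intro subsetD[OF flow_exists[OF s x]]) auto
    then have "flow s x t \<in> max_sol_image (averaged f) s (closed_nbhd \<mu> (K s)) t"
      using x by (auto simp: flow_def max_sol_image_def)
    then have "ennreal (infdist (flow s x t) (K t)) \<le> semidist (max_sol_image (averaged f) s (closed_nbhd \<mu> (K s)) t) (K t)"
      unfolding semidist_def by (rule SUP_upper)
    also have "\<dots> < ennreal e" using T0[of "t - s" s] s t by simp
    finally show "infdist (flow s x t) (K t) \<le> e"
      using e by (subst (asm) ennreal_less_iff) (auto simp: infdist_nonneg)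
  qed simp
qed

text \<open>Attraction controls the flow only after some time \<open>T\<close>, and solutions starting in the
  \<open>\<mu>\<close>-neighbourhood may make large excursions before; shrinking the neighbourhood by
  \<open>exp (L * T)\<close> excludes them by comparison with a solution on the attractor.\<close>

lemma stability:
  assumes \<sigma>: "0 < \<sigma>" "\<sigma> \<le> 1"
  obtains \<eta> where "\<eta> > 0" "\<eta> \<le> \<sigma>" "\<eta> \<le> \<mu>"
    and "\<And>s x t. s \<ge> 0 \<Longrightarrow> infdist x (K s) \<le> \<eta> \<Longrightarrow> t \<ge> s \<Longrightarrow> infdist (flow s x t) (K t) \<le> \<sigma>"
proof -
  \<comment> \<open>Solutions on the attractor stay in the ball of radius \<open>k\<close>, and the
    compared solution stays within \<open>\<sigma> \<le> 1\<close> of them.\<close>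
  define r where "r = k + 1"
  have r: "r > 0" using k by (simp add: r_def)
  obtain T where T: "T > 0"
    "\<And>s x t. s \<ge> 0 \<Longrightarrow> x \<in> closed_nbhd \<mu> (K s) \<Longrightarrow> t \<ge> s + T \<Longrightarrow> infdist (flow s x t) (K t) \<le> \<sigma>"
    using attraction_time[OF \<sigma>(1)] by metis
  obtain L where L: "L > 0" "\<And>t x y. t \<ge> 0 \<Longrightarrow> norm x \<le> r \<Longrightarrow> norm y \<le> r \<Longrightarrow>
      norm (averaged f t x - averaged f t y) \<le> L * norm (x - y)"
    using lipschitz_constant[OF r] by metis
  \<comment> \<open>Growth by \<open>exp (L * T)\<close> brings the distance back to at most
    \<sigma>; the minimum with \<mu> keeps the starting point in the region of attraction.\<close>
  define \<eta> where "\<eta> = min \<sigma> \<mu> / exp (L * T)"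
  have m: "min \<sigma> \<mu> > 0" using \<sigma> \<mu>_pos by simp
  have "\<eta> \<le> min \<sigma> \<mu> / 1"
    unfolding \<eta>_def using m L T by (intro divide_left_mono) auto
  then have \<eta>: "\<eta> > 0" "\<eta> \<le> \<sigma>" "\<eta> \<le> \<mu>" using m by (auto simp: \<eta>_def)
  have \<eta>exp: "\<eta> * exp (L * T) \<le> \<sigma>" by (simp add: \<eta>_def)
  show thesis
  proof (rule that[OF \<eta>])
    fix s x t assume s: "s \<ge> 0" and x: "infdist x (K s) \<le> \<eta>" and t: "t \<ge> s"
    have xn: "x \<in> closed_nbhd \<mu> (K s)" using x s \<eta> by (intro nbhd_memI) auto
    show "infdist (flow s x t) (K t) \<le> \<sigma>"
    proof (cases "t \<ge> s + T")
      case True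
      then show ?thesis using T(2) s xn by blast
    next
      case False
      obtain c where c: "c \<in> K s" "infdist x (K s) = dist x c"
        using infdist_attains_inf[OF K_closed K_nonempty] s by blast
      have cn: "c \<in> closed_nbhd \<mu> (K s)" using c s \<mu>_pos by (intro nbhd_memI) auto
      have zK: "flow s c u \<in> K u" if "u \<ge> s" for u using flow_invariant s c that by blast
      have zr: "norm (flow s c u) < k" if "u \<ge> s" for u using zK[OF that] k(2) s that by fastforce
      \<comment> \<open>The flow from \<open>x\<close> is not yet known to stay where
        \<open>L\<close> is valid, so a cut-off solution is compared instead. Once it is seen to
        remain in the ball it solves the averaged equation, and uniqueness identifies it with the
        flow.\<close>
      obtain w where w: "w s = x"
        "\<And>u. u \<ge> s \<Longrightarrow> (w has_vector_derivative averaged f u (cutoff r (w u))) (at u within {s..})"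
        using exists_averaged_cutoff_solution[OF r s] by blast
      have dw: "(w has_vector_derivative averaged f u (cutoff r (w u))) (at u within {s..s + T})"
        if "u \<in> {s..s + T}" for u
        by (rule has_vector_derivative_within_subset[OF w(2)]) (use that in auto)
      have wz: "norm (w u - flow s c u) \<le> \<sigma>" if u: "u \<in> {s..s + T}" for u
      proof -
        have "norm (w u - flow s c u) \<le> norm (w s - flow s c s) * exp (L * (u - s))"
        proof (rule solution_dist_le[where g = "\<lambda>t y. averaged f t (cutoff r y)", OF dw _ _ _ u])
          fix v assume v: "v \<in> {s..s + T}"
          have "cutoff r (flow s c v) = flow s c v"
            using zr[of v] v by (intro cutoff_eq) (simp add: r_def)
          then show "(flow s c has_vector_derivative averaged f v (cutoff r (flow s c v))) (at v within {s..s + T})"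
            using v flow_solution[OF s cn, of "{s..s + T}" v] by auto
          have "norm (averaged f v (cutoff r (w v)) - averaged f v (cutoff r (flow s c v)))
              \<le> L * norm (cutoff r (w v) - cutoff r (flow s c v))"
            using v s r by (intro L norm_cutoff_le) auto
          also have "\<dots> \<le> L * norm (w v - flow s c v)"
            using L r by (intro mult_left_mono norm_cutoff_diff_le) auto
          finally show "norm (averaged f v (cutoff r (w v)) - averaged f v (cutoff r (flow s c v)))
              \<le> L * norm (w v - flow s c v)" .
        qed (use L in auto)
        also have "norm (w s - flow s c s) \<le> \<eta>" using w(1) flow_initial[OF s] c x by (simp add: dist_norm)
        then have "norm (w s - flow s c s) * exp (L * (u - s)) \<le> \<eta> * exp (L * T)"
          using u L \<eta> by (intro mult_mono) auto
        finally show ?thesis using \<eta>exp by simp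
      qed
      have "max_sol (averaged f) s x t = Some (w t)"
      proof (rule max_sol_eqI[where J = "{s..s + T}", OF lipschitz_on_balls_averaged s])
        fix u assume u: "u \<in> {s..s + T}"
        have "norm (w u) \<le> norm (flow s c u) + norm (w u - flow s c u)" by (rule norm_triangle_sub)
        then have "norm (w u) \<le> r" using wz[OF u] zr[of u] u \<sigma> by (simp add: r_def)
        then show "(w has_vector_derivative averaged f u (w u)) (at u within {s..s + T})"
          using dw[OF u] by (simp add: cutoff_eq)
      qed (use w(1) T t False in \<open>auto simp: is_interval_cc\<close>)
      then have "flow s x t = w t" by (simp add: flow_def)
      moreover have "infdist (w t) (K t) \<le> dist (w t) (flow s c t)" by (rule infdist_le[OF zK[OF t]])
      ultimately show ?thesis using wz[of t] t False by (simp add: dist_norm)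
    qed
  qed
qed

lemma slow_solution_near_attractor:
  assumes xhat: "infdist xhat (K 0) \<le> \<mu>" and \<sigma>: "\<sigma> > 0"
  obtains T \<epsilon>0 where "T > 0" "\<epsilon>0 > 0"
    and "\<And>\<epsilon>. 0 < \<epsilon> \<Longrightarrow> \<epsilon> < \<epsilon>0 \<Longrightarrow> \<exists>x. x 0 = xhat \<and>
      (\<forall>t\<ge>0. (x has_vector_derivative f (t / \<epsilon>) t (x t)) (at t within {0..})) \<and>
      (\<forall>t\<ge>T. infdist (x t) (K t) \<le> \<sigma>)"
proof -
  \<comment> \<open>Within a block the distance to the attractor is at most
    \<open>\<sigma>1 + \<eta> / 2\<close>. Halving keeps this below \<sigma>, and below 1 so that
    the ball of radius \<open>k + 1\<close> is not left.\<close>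
  define \<sigma>1 where "\<sigma>1 = min \<sigma> 1 / 2"
  have \<sigma>1: "0 < \<sigma>1" "\<sigma>1 \<le> 1" "\<sigma>1 + \<sigma>1 \<le> \<sigma>" "\<sigma>1 + \<sigma>1 \<le> 1" using \<sigma> by (auto simp: \<sigma>1_def)
  obtain \<eta> where \<eta>: "\<eta> > 0" "\<eta> \<le> \<sigma>1" "\<eta> \<le> \<mu>"
    and stable: "\<And>s x t. s \<ge> 0 \<Longrightarrow> infdist x (K s) \<le> \<eta> \<Longrightarrow> t \<ge> s \<Longrightarrow> infdist (flow s x t) (K t) \<le> \<sigma>1"
    using stability[OF \<sigma>1(1,2)] by metis
  have "\<eta> / 2 > 0" using \<eta> by simp
  then obtain T where T: "T > 0"
    and attract: "\<And>s x t. s \<ge> 0 \<Longrightarrow> x \<in> closed_nbhd \<mu> (K s) \<Longrightarrow> t \<ge> s + T \<Longrightarrow> infdist (flow s x t) (K t) \<le> \<eta> / 2"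
    using attraction_time by metis
  have xn: "xhat \<in> closed_nbhd \<mu> (K 0)" by (rule nbhd_memI[OF order_refl xhat])
  have "compact (flow 0 xhat ` {0..T})"
    by (intro compact_continuous_image continuous_on_vector_derivative[OF flow_solution[OF order_refl xn]]) auto
  then have "bounded (flow 0 xhat ` {0..T})" by (rule compact_imp_bounded)
  then obtain B where B: "B > 0" "\<And>t. t \<in> {0..T} \<Longrightarrow> norm (flow 0 xhat t) \<le> B"
    unfolding bounded_pos by blast
  \<comment> \<open>\<open>B + 1\<close> serves the first interval, where the orbit of
    \<open>xhat\<close> may be far from the attractor, and \<open>k + 1\<close> all later
    times.\<close>
  define r where "r = max (k + 1) (B + 1)"
  have r: "r > 0" "r \<ge> k + 1" "r \<ge> B + 1" using k B by (auto simp: r_def)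
  obtain \<epsilon>0 where \<epsilon>0: "\<epsilon>0 > 0"
    and avg: "\<And>\<epsilon> s x w t. 0 < \<epsilon> \<Longrightarrow> \<epsilon> < \<epsilon>0 \<Longrightarrow> 0 \<le> s \<Longrightarrow> x s = w s \<Longrightarrow>
      (\<And>t. t \<in> {s..s + T} \<Longrightarrow> (x has_vector_derivative f (t / \<epsilon>) t (cutoff r (x t))) (at t within {s..s + T})) \<Longrightarrow>
      (\<And>t. t \<in> {s..s + T} \<Longrightarrow> (w has_vector_derivative averaged f t (cutoff r (w t))) (at t within {s..s + T})) \<Longrightarrow>
      t \<in> {s..s + T} \<Longrightarrow> norm (x t - w t) \<le> \<eta> / 2"
    by (rule averaging_cutoff[OF r(1) \<open>\<eta> / 2 > 0\<close> T]) blast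
  show thesis
  proof (rule that[OF T \<epsilon>0])
    fix \<epsilon> assume \<epsilon>: "0 < \<epsilon>" "\<epsilon> < \<epsilon>0"
    obtain x where x: "x 0 = xhat"
      "\<And>t. t \<ge> 0 \<Longrightarrow> (x has_vector_derivative f (t / \<epsilon>) t (cutoff r (x t))) (at t within {0..})"
      using exists_slow_cutoff_solution[OF r(1) \<epsilon>(1)] by blast
    \<comment> \<open>The averaged solution is restarted at the point \<open>x s\<close>. As it
      stays in the ball, it also solves the cut-off equation, and the comparison applies.\<close>
    have shadow: "norm (x t - flow s (x s) t) \<le> \<eta> / 2"
      if s: "s \<ge> 0" and n: "x s \<in> closed_nbhd \<mu> (K s)"
        and zr: "\<And>u. u \<in> {s..s + T} \<Longrightarrow> norm (flow s (x s) u) \<le> r" and t: "t \<in> {s..s + T}" for s t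
    proof (rule avg[OF \<epsilon> s _ _ _ t])
      show "x s = flow s (x s) s" using flow_initial[OF s] by simp
      fix u assume u: "u \<in> {s..s + T}"
      show "(x has_vector_derivative f (u / \<epsilon>) u (cutoff r (x u))) (at u within {s..s + T})"
        by (rule has_vector_derivative_within_subset[OF x(2)]) (use s u in auto)
      show "(flow s (x s) has_vector_derivative averaged f u (cutoff r (flow s (x s) u))) (at u within {s..s + T})"
        using flow_solution[OF s n _ u] zr[OF u] by (simp add: cutoff_eq)
    qed
    have start: "norm (x t - flow 0 xhat t) \<le> \<eta> / 2" if "t \<in> {0..T}" for t
      using shadow[of 0 t] that x(1) xn B(2) r(3) by fastforce
    have block: "infdist (x t) (K t) \<le> \<sigma>1 + \<eta> / 2 \<and> infdist (x (s + T)) (K (s + T)) \<le> \<eta>"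
      if s: "s \<ge> 0" and xs: "infdist (x s) (K s) \<le> \<eta>" and t: "t \<in> {s..s + T}" for s t
    proof -
      have n: "x s \<in> closed_nbhd \<mu> (K s)" using xs \<eta> s by (intro nbhd_memI) auto
      have zK: "infdist (flow s (x s) u) (K u) \<le> \<sigma>1" if "u \<in> {s..s + T}" for u
        using stable[OF s xs] that by auto
      have zr: "norm (flow s (x s) u) \<le> r" if "u \<in> {s..s + T}" for u
        using norm_le_of_infdist_K[OF _ zK[OF that]] that s \<sigma>1(2) r(2) by auto
      have sh: "norm (x u - flow s (x s) u) \<le> \<eta> / 2" if "u \<in> {s..s + T}" for u
        by (rule shadow[OF s n _ that]) (rule zr)
      have "infdist (x t) (K t) \<le> infdist (flow s (x s) t) (K t) + dist (x t) (flow s (x s) t)"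
        by (rule infdist_triangle)
      moreover have "infdist (x (s + T)) (K (s + T)) \<le> infdist (flow s (x s) (s + T)) (K (s + T)) + dist (x (s + T)) (flow s (x s) (s + T))"
        by (rule infdist_triangle)
      ultimately show ?thesis
        using sh[OF t] sh[of "s + T"] zK[OF t] attract[OF s n order_refl] T by (simp add: dist_norm)
    qed
    \<comment> \<open>The count starts at one block because \<open>xhat\<close> is only \<mu>-close
      at time 0; \<eta>-closeness is first reached at time \<open>T\<close>.\<close>
    have grid: "infdist (x (real (Suc n) * T)) (K (real (Suc n) * T)) \<le> \<eta>" for n
    proof (induction n)
      case 0
      have "infdist (x T) (K T) \<le> infdist (flow 0 xhat T) (K T) + dist (x T) (flow 0 xhat T)"
        by (rule infdist_triangle)
      then show ?case using start[of T] attract[OF order_refl xn, of T] T by (simp add: dist_norm)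
    next
      case (Suc n)
      have "real (Suc n) * T \<ge> 0" using T by simp
      moreover have "real (Suc n) * T \<in> {real (Suc n) * T..real (Suc n) * T + T}" using T by simp
      moreover have "real (Suc n) * T + T = real (Suc (Suc n)) * T" by (simp add: algebra_simps)
      ultimately show ?case using block[OF _ Suc.IH] by metis
    qed
    have late: "infdist (x t) (K t) \<le> \<sigma>1 + \<eta> / 2" if t: "t \<ge> T" for t
    proof -
      \<comment> \<open>The 1 is subtracted because \<open>grid n\<close> concerns the time
        \<open>Suc n * T\<close>; for \<open>t \<ge> T\<close> the floor is at least 1, so
        \<open>nat\<close> truncates nothing.\<close>
      define n where "n = nat (\<lfloor>t / T\<rfloor> - 1)"
      have "1 \<le> t / T" using t T by simp
      then have "real (Suc n) = of_int \<lfloor>t / T\<rfloor>" by (simp add: n_def)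
      then have "real (Suc n) \<le> t / T" "t / T < real (Suc n) + 1" by linarith+
      then have "t \<in> {real (Suc n) * T..real (Suc n) * T + T}" using T by (simp add: field_simps)
      with block[OF _ grid[of n] this] T show ?thesis by simp
    qed
    \<comment> \<open>The cutoff thus never acts on \<open>x\<close>, which therefore solves the
      original equation on the whole half-line.\<close>
    have "norm (x t) \<le> r" if t: "t \<ge> 0" for t
    proof (cases "t \<ge> T")
      case True
      then show ?thesis using norm_le_of_infdist_K[OF t late] \<eta>(1,2) \<sigma>1(4) r(2) by simp
    next
      case False
      have "norm (x t) \<le> norm (flow 0 xhat t) + norm (x t - flow 0 xhat t)" by (rule norm_triangle_sub)
      then show ?thesis using start[of t] B(2)[of t] False t \<eta>(1,2) \<sigma>1(2) r(3) by simp
    qed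
    then have "(x has_vector_derivative f (t / \<epsilon>) t (x t)) (at t within {0..})" if "t \<ge> 0" for t
      using x(2)[OF that] that by (simp add: cutoff_eq)
    moreover have "infdist (x t) (K t) \<le> \<sigma>" if "t \<ge> T" for t
      using late[OF that] \<eta>(1,2) \<sigma>1(3) by simp
    ultimately show "\<exists>x. x 0 = xhat \<and>
      (\<forall>t\<ge>0. (x has_vector_derivative f (t / \<epsilon>) t (x t)) (at t within {0..})) \<and>
      (\<forall>t\<ge>T. infdist (x t) (K t) \<le> \<sigma>)" using x(1) by blast
  qed
qed

end

section \<open>Passage to fast time and conclusion\<close>

lemma fast_time_rescale:
  fixes x :: "real \<Rightarrow> 'a::real_normed_vector"
  assumes x: "\<And>t. t \<ge> 0 \<Longrightarrow> (x has_vector_derivative f (t / \<epsilon>) t (x t)) (at t within {0..})"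
    and "\<epsilon> > 0" "\<tau> \<ge> 0"
  shows "((\<lambda>\<tau>. x (\<epsilon> * \<tau>)) has_vector_derivative \<epsilon> *\<^sub>R f \<tau> (\<epsilon> * \<tau>) (x (\<epsilon> * \<tau>))) (at \<tau> within {0..})"
proof -
  have "((*) \<epsilon> has_vector_derivative \<epsilon>) (at \<tau> within {0..})"
    by (auto intro!: derivative_eq_intros simp: has_real_derivative_iff_has_vector_derivative[symmetric])
  moreover have "(x has_vector_derivative f \<tau> (\<epsilon> * \<tau>) (x (\<epsilon> * \<tau>))) (at (\<epsilon> * \<tau>) within (*) \<epsilon> ` {0..})"
    using x[of "\<epsilon> * \<tau>"] assms(2,3) by (auto intro: has_vector_derivative_within_subset)
  ultimately show ?thesis
    using vector_diff_chain_within by (fastforce simp: o_def)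
qed

theorem theorem6p2:
  fixes f :: "real \<Rightarrow> real \<Rightarrow> real ^ 'n \<Rightarrow> real ^ 'n"
    and K :: "real \<Rightarrow> (real ^ 'n) set"
    and \<mu> :: real
    and xhat :: "real ^ 'n"
  assumes a: "\<And>r::real. r > 0 \<Longrightarrow>
      bounded ((\<lambda>(\<tau>, t, x). f \<tau> t x) ` ({0..} \<times> {0..} \<times> {x. norm x \<le> r})) \<and>
      continuous_on ({0..} \<times> {0..} \<times> {x. norm x \<le> r}) (\<lambda>(\<tau>, t, x). f \<tau> t x)"
    and b: "\<And>r::real. r > 0 \<Longrightarrow>
      \<exists>\<theta> L. modulus_of_continuity \<theta> \<and> L > 0 \<and>
        (\<forall>\<tau>\<ge>0. \<forall>t1\<ge>0. \<forall>t2\<ge>0. \<forall>x1 x2. norm x1 \<le> r \<and> norm x2 \<le> r \<longrightarrow>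
          ennreal (norm (f \<tau> t1 x1 - f \<tau> t2 x2))
            \<le> \<theta> \<bar>t1 - t2\<bar> + ennreal (L * norm (x1 - x2)))"
    and c: "\<And>t x. t \<ge> 0 \<Longrightarrow> \<exists>l. ((\<lambda>T. time_mean f T 0 t x) \<longlongrightarrow> l) at_top"
    and d: "\<And>r::real. r > 0 \<Longrightarrow>
      uniform_limit ({0..} \<times> {0..} \<times> {x. norm x \<le> r})
        (\<lambda>T (\<tau>, t, x). time_mean f T \<tau> t x) (\<lambda>(\<tau>, t, x). averaged f t x) at_top"
    and attractor: "uniform_local_attractor (averaged f) K \<mu>"
    and K_bounded: "\<exists>k>0. (\<Union>t\<in>{0..}. K t) \<subseteq> {x. norm x < k}"
    and xhat: "infdist xhat (K 0) \<le> \<mu>"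
  shows "\<forall>\<sigma>>0. \<exists>t\<^sub>\<sigma>>0. \<exists>\<epsilon>\<^sub>\<sigma>>0. \<forall>\<epsilon>. 0 < \<epsilon> \<and> \<epsilon> < \<epsilon>\<^sub>\<sigma> \<longrightarrow>
      ((\<forall>t>0. t \<in> dom (slow_time_sol f \<epsilon> 0 xhat)) \<and>
       (\<forall>t\<ge>t\<^sub>\<sigma>. infdist (the (slow_time_sol f \<epsilon> 0 xhat t)) (K t) \<le> \<sigma>)) \<and>
      ((\<forall>\<tau>>0. \<tau> \<in> dom (fast_time_sol f \<epsilon> 0 xhat)) \<and>
       (\<forall>\<tau>\<ge>t\<^sub>\<sigma> / \<epsilon>. infdist (the (fast_time_sol f \<epsilon> 0 xhat \<tau>)) (K (\<epsilon> * \<tau>)) \<le> \<sigma>))"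
proof (intro allI impI)
  fix \<sigma> :: real assume \<sigma>: "\<sigma> > 0"
  obtain k where k: "k > 0" "(\<Union>t\<in>{0..}. K t) \<subseteq> {x. norm x < k}" using K_bounded by blast
  interpret averaging_attractor f K \<mu> k
    by unfold_locales (fact a b c d attractor k)+
  obtain T \<epsilon>0 where T: "T > 0" and \<epsilon>0: "\<epsilon>0 > 0"
    and sol: "\<And>\<epsilon>. 0 < \<epsilon> \<Longrightarrow> \<epsilon> < \<epsilon>0 \<Longrightarrow> \<exists>x. x 0 = xhat \<and>
      (\<forall>t\<ge>0. (x has_vector_derivative f (t / \<epsilon>) t (x t)) (at t within {0..})) \<and>
      (\<forall>t\<ge>T. infdist (x t) (K t) \<le> \<sigma>)"
    by (rule slow_solution_near_attractor[OF xhat \<sigma>]) blast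
  show "\<exists>t\<^sub>\<sigma>>0. \<exists>\<epsilon>\<^sub>\<sigma>>0. \<forall>\<epsilon>. 0 < \<epsilon> \<and> \<epsilon> < \<epsilon>\<^sub>\<sigma> \<longrightarrow>
      ((\<forall>t>0. t \<in> dom (slow_time_sol f \<epsilon> 0 xhat)) \<and>
       (\<forall>t\<ge>t\<^sub>\<sigma>. infdist (the (slow_time_sol f \<epsilon> 0 xhat t)) (K t) \<le> \<sigma>)) \<and>
      ((\<forall>\<tau>>0. \<tau> \<in> dom (fast_time_sol f \<epsilon> 0 xhat)) \<and>
       (\<forall>\<tau>\<ge>t\<^sub>\<sigma> / \<epsilon>. infdist (the (fast_time_sol f \<epsilon> 0 xhat \<tau>)) (K (\<epsilon> * \<tau>)) \<le> \<sigma>))"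
  proof (rule exI[of _ T], rule conjI[OF T], rule exI[of _ \<epsilon>0], rule conjI[OF \<epsilon>0], intro allI impI)
    fix \<epsilon> assume \<epsilon>: "0 < \<epsilon> \<and> \<epsilon> < \<epsilon>0"
    then obtain x where x0: "x 0 = xhat"
      and x: "\<And>t. t \<ge> 0 \<Longrightarrow> (x has_vector_derivative f (t / \<epsilon>) t (x t)) (at t within {0..})"
      and xK: "\<And>t. t \<ge> T \<Longrightarrow> infdist (x t) (K t) \<le> \<sigma>"
      using sol by blast
    have slow: "slow_time_sol f \<epsilon> 0 xhat t = Some (x t)" if "t \<ge> 0" for t
      unfolding slow_time_sol_def
      by (rule max_sol_eqI[OF lipschitz_on_balls_slow, where J = "{0..}"])
        (use \<epsilon> x0 x that in \<open>auto simp: is_interval_ci\<close>)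
    have fast_deriv: "((\<lambda>\<tau>. x (\<epsilon> * \<tau>)) has_vector_derivative \<epsilon> *\<^sub>R f \<tau> (\<epsilon> * \<tau>) (x (\<epsilon> * \<tau>))) (at \<tau> within {0..})"
      if "\<tau> \<ge> 0" for \<tau>
      by (rule fast_time_rescale) (use x \<epsilon> that in auto)
    \<comment> \<open>The rescaled function is itself a solution on the whole half-line, so the fast
      form follows from the same \<open>x\<close> by uniqueness.\<close>
    have fast: "fast_time_sol f \<epsilon> 0 xhat \<tau> = Some (x (\<epsilon> * \<tau>))" if "\<tau> \<ge> 0" for \<tau>
      unfolding fast_time_sol_def
      by (rule max_sol_eqI[OF lipschitz_on_balls_fast, where J = "{0..}" and u = "\<lambda>\<tau>. x (\<epsilon> * \<tau>)"])
        (use \<epsilon> x0 fast_deriv that in \<open>auto simp: is_interval_ci\<close>)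
    have "infdist (the (fast_time_sol f \<epsilon> 0 xhat \<tau>)) (K (\<epsilon> * \<tau>)) \<le> \<sigma>" if "\<tau> \<ge> T / \<epsilon>" for \<tau>
    proof -
      have "\<epsilon> * \<tau> \<ge> T" using that \<epsilon> by (simp add: field_simps)
      moreover have "\<tau> \<ge> 0" using that T \<epsilon> by (meson divide_nonneg_pos less_imp_le order_trans)
      ultimately show ?thesis using fast xK by simp
    qed
    then show "((\<forall>t>0. t \<in> dom (slow_time_sol f \<epsilon> 0 xhat)) \<and>
       (\<forall>t\<ge>T. infdist (the (slow_time_sol f \<epsilon> 0 xhat t)) (K t) \<le> \<sigma>)) \<and>
      ((\<forall>\<tau>>0. \<tau> \<in> dom (fast_time_sol f \<epsilon> 0 xhat)) \<and>
       (\<forall>\<tau>\<ge>T / \<epsilon>. infdist (the (fast_time_sol f \<epsilon> 0 xhat \<tau>)) (K (\<epsilon> * \<tau>)) \<le> \<sigma>))"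
      using slow fast xK T by (simp add: dom_def)
  qed
qed

end
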